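(* Let $n\ge 1$ and let $D_n=\langle a,b\mid a^n=b^2=1,\ bab=a^{-1}\rangle$ be the dihedral group of order $2n$. Let $S=S_1\cup S_2\subseteq D_n\setminus\{1\}$ with $S=S^{-1}$, where $S_1\subseteq\langle a\rangle$ and $S_2\subseteq b\langle a\rangle$. Then the Cayley graph $X(D_n,S)$ is integral if and only if $S_1\in B(\langle a\rangle)$ and $2\chi_h(S_2^2)$ is a square number for all $1\le h\le \lfloor\frac{n-1}{2}\rfloor$.
   Context: For a finite group $G$ and $S\subseteq G\setminus\{1\}$ with $S=S^{-1}$, the Cayley graph $X(G,S)$ has vertex set $G$, two vertices $x,y$ being adjacent iff $x^{-1}y\in S$. A graph is integral if all eigenvalues of its adjacency matrix are integers. For $1\le h\le\lfloor\frac{n-1}{2}\rfloor$, $\chi_h$ denotes the irreducible character of $D_n$ of degree $2$ given by $\chi_h(a^k)=2\cos(\frac{2kh\pi}{n})$ and $\chi_h(ba^k)=0$. For a subset $A\subseteq D_n$, $A^2$ is the multiset $\{xy: x,y\in A\}$ (one entry for each ordered pair), and $\chi_h(A^2)=\sum_{x,y\in A}\chi_h(xy)$. A square number is an integer of the form $w^2$ with $w\in\mathbb{Z}$. $B(\langle a\rangle)$ is the Boolean algebra of subsets of the cyclic group $\langle a\rangle$ generated by all subgroups of $\langle a\rangle$ under finite unions, intersections and complements; equivalently, its elements are exactly the unions of atoms $[g]=\{x\in\langle a\rangle:\langle x\rangle=\langle g\rangle\}$, $g\in\langle a\rangle$. *)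

theory Defs
  imports
    "HOL-Library.Multiset"
    "HOL-Algebra.Multiplicative_Group"
    "Graph_Theory.Pair_Digraph"
    "Jordan_Normal_Form.Char_Poly"
begin

text \<open>
  A group generated by \<open>a\<close> and \<open>b\<close> that satisfies the relations below is a quotient of the
  presented group, which has order \<open>2n\<close>; the condition on the order therefore says that
  no further relations hold. No case is excluded: for \<open>n = 1\<close> this is the group of order 2, for
  \<open>n = 2\<close> the Klein four-group.
\<close>

locale dihedral_group = group G for G :: "('g, 'm) monoid_scheme" (structure) +
  fixes n :: nat and a b :: 'g
  assumes n_pos: "n \<ge> 1"
    and a_closed: "a \<in> carrier G"
    and b_closed: "b \<in> carrier G"
    and generated: "generate G {a, b} = carrier G"
    and a_pow_n: "a [^] n = \<one>"
    and b_pow_2: "b [^] (2::nat) = \<one>"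
    and conj_rel: "b \<otimes> a \<otimes> b = inv a"
    and order_eq: "Coset.order G = 2 * n"

definition cayley_graph :: "('g, 'm) monoid_scheme \<Rightarrow> 'g set \<Rightarrow> 'g pair_pre_digraph" where
  "cayley_graph G S =
     \<lparr> pverts = carrier G,
       parcs = {(x, y). x \<in> carrier G \<and> y \<in> carrier G \<and> inv\<^bsub>G\<^esub> x \<otimes>\<^bsub>G\<^esub> y \<in> S} \<rparr>"

definition adjacency_matrix :: "'v pair_pre_digraph \<Rightarrow> 'v list \<Rightarrow> complex mat" where
  "adjacency_matrix X vs =
     mat (length vs) (length vs) (\<lambda>(i, j). if (vs ! i, vs ! j) \<in> parcs X then 1 else 0)"

text \<open>
  The list \<open>vs\<close> is an ordering of the vertices. The spectrum does not depend on it, so for a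
  finite graph, where an ordering exists, it makes no difference that all of them are considered.
\<close>

definition integral_graph :: "'v pair_pre_digraph \<Rightarrow> bool" where
  "integral_graph X \<longleftrightarrow>
     finite (pverts X) \<and>
     (\<forall>vs. distinct vs \<and> set vs = pverts X \<longrightarrow>
        (\<forall>k. eigenvalue (adjacency_matrix X vs) k \<longrightarrow> k \<in> \<int>))"

abbreviation cyclic_subgroup :: "('g, 'm) monoid_scheme \<Rightarrow> 'g \<Rightarrow> ('g, 'm) monoid_scheme" where
  "cyclic_subgroup G a \<equiv> G \<lparr> carrier := generate G {a} \<rparr>"

inductive_set subgroup_algebra :: "('g, 'm) monoid_scheme \<Rightarrow> 'g set set"
  for C :: "('g, 'm) monoid_scheme" where
  subgroup: "subgroup H C \<Longrightarrow> H \<in> subgroup_algebra C"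
| union: "A \<in> subgroup_algebra C \<Longrightarrow> B \<in> subgroup_algebra C \<Longrightarrow> A \<union> B \<in> subgroup_algebra C"
| inter: "A \<in> subgroup_algebra C \<Longrightarrow> B \<in> subgroup_algebra C \<Longrightarrow> A \<inter> B \<in> subgroup_algebra C"
| compl: "A \<in> subgroup_algebra C \<Longrightarrow> carrier C - A \<in> subgroup_algebra C"

text \<open>
  The exponent of a power of \<open>a\<close> is only determined modulo \<open>n\<close>; the least one is used here, and
  the lemmas \<open>dihedral_char_rot\<close> and \<open>dihedral_char_refl\<close> show that the usual
  formulas hold for all exponents.
\<close>

definition dihedral_char ::
    "('g, 'm) monoid_scheme \<Rightarrow> nat \<Rightarrow> 'g \<Rightarrow> nat \<Rightarrow> 'g \<Rightarrow> real" where
  "dihedral_char G n a h x =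
     (if x \<in> generate G {a}
      then 2 * cos (2 * real (LEAST k. x = a [^]\<^bsub>G\<^esub> k) * real h * pi / real n)
      else 0)"

definition mset_square :: "('g, 'm) monoid_scheme \<Rightarrow> 'g set \<Rightarrow> 'g multiset" where
  "mset_square G A = image_mset (\<lambda>(x, y). x \<otimes>\<^bsub>G\<^esub> y) (mset_set (A \<times> A))"

definition mset_char :: "('g \<Rightarrow> real) \<Rightarrow> 'g multiset \<Rightarrow> real" where
  "mset_char \<chi> M = (\<Sum>x\<in>#M. \<chi> x)"

definition is_square_number :: "real \<Rightarrow> bool" where
  "is_square_number r \<longleftrightarrow> (\<exists>w::int. r = of_int (w\<^sup>2))"

context dihedral_group
begin

lemma b_sq: "b \<otimes> b = \<one>"
  using b_pow_2 b_closed by (simp add: numeral_2_eq_2)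

lemma finite_carrier: "finite (carrier G)"
  using order_eq n_pos unfolding Coset.order_def by (metis card.infinite mult_eq_0_iff not_one_le_zero zero_neq_numeral)

lemma ord_a_dvd: "ord a dvd n"
  using pow_eq_id[OF a_closed] a_pow_n by blast

lemma cyclic_eq: "generate G {a} = {a [^] k | k::nat. True}"
  using generate_pow_on_finite_carrier[OF finite_carrier a_closed] by auto

lemma inv_a: "inv a = a [^] (n - 1)"
proof -
  have "a [^] (n - 1) \<otimes> a = \<one>"
    using a_pow_n n_pos a_closed by (metis Suc_diff_1 nat_pow_Suc less_eq_Suc_le One_nat_def)
  then show ?thesis using a_closed by (simp add: inv_equality)
qed

lemma a_b: "a \<otimes> b = b \<otimes> inv a"
proof -
  have "b \<otimes> inv a = b \<otimes> (b \<otimes> a \<otimes> b)" by (simp add: conj_rel)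
  also have "\<dots> = (b \<otimes> b) \<otimes> (a \<otimes> b)" using a_closed b_closed by (simp add: m_assoc)
  finally show ?thesis using b_sq a_closed b_closed by simp
qed

lemma pow_b: "a [^] (k::nat) \<otimes> b = b \<otimes> (inv a) [^] k"
proof (induction k)
  case 0
  then show ?case using b_closed by simp
next
  case (Suc k)
  have "a [^] Suc k \<otimes> b = a [^] k \<otimes> (a \<otimes> b)"
    using a_closed b_closed by (simp add: m_assoc)
  also have "\<dots> = (a [^] k \<otimes> b) \<otimes> inv a"
    using a_closed b_closed by (simp add: a_b m_assoc)
  also have "\<dots> = b \<otimes> (inv a) [^] Suc k"
    using a_closed b_closed Suc by (simp add: m_assoc)
  finally show ?case .
qed

lemma normal_form: "carrier G = generate G {a} \<union> (\<lambda>x. b \<otimes> x) ` generate G {a}"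
proof
  let ?C = "generate G {a}"
  have sub: "subgroup ?C G" using a_closed by (simp add: generate_is_subgroup)
  have Cc: "x \<in> carrier G" if "x \<in> ?C" for x using sub that subgroup.mem_carrier by fastforce
  have Cm: "x \<otimes> y \<in> ?C" if "x \<in> ?C" "y \<in> ?C" for x y using sub that by (simp add: subgroup.m_closed)
  have C1: "\<one> \<in> ?C" using sub by (simp add: subgroup.one_closed)
  have aC: "a \<in> ?C" by (simp add: generate.incl)
  have iC: "inv a \<in> ?C" by (simp add: generate.inv)
  have ipC: "(inv a) [^] (k::nat) \<in> ?C" for k
    by (induction k) (auto simp: C1 iC intro: Cm)
  show "?C \<union> (\<lambda>x. b \<otimes> x) ` ?C \<subseteq> carrier G" using Cc b_closed by auto
  have Cb: "\<exists>y\<in>?C. x \<otimes> b = b \<otimes> y" if "x \<in> ?C" for x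
    using that pow_b ipC by (auto simp: cyclic_eq) (metis)
  let ?N = "?C \<union> (\<lambda>x. b \<otimes> x) ` ?C"
  have prod: "x \<otimes> y \<in> ?N" if x: "x \<in> ?N" and y: "y \<in> ?N" for x y
  proof -
    consider (1) "x \<in> ?C" "y \<in> ?C"
      | (2) z where "x \<in> ?C" "z \<in> ?C" "y = b \<otimes> z"
      | (3) w where "w \<in> ?C" "x = b \<otimes> w" "y \<in> ?C"
      | (4) w z where "w \<in> ?C" "x = b \<otimes> w" "z \<in> ?C" "y = b \<otimes> z"
      using x y by blast
    then show ?thesis
    proof cases
      case 1
      then show ?thesis using Cm by blast
    next
      case 2
      obtain u where u: "u \<in> ?C" "x \<otimes> b = b \<otimes> u" using Cb 2 by blast
      have "x \<otimes> y = b \<otimes> (u \<otimes> z)"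
        using 2 u Cc b_closed by (simp add: m_assoc[symmetric])
      then show ?thesis using Cm u 2 by blast
    next
      case 3
      have "x \<otimes> y = b \<otimes> (w \<otimes> y)" using 3 Cc b_closed by (simp add: m_assoc)
      then show ?thesis using Cm 3 by blast
    next
      case 4
      obtain u where u: "u \<in> ?C" "w \<otimes> b = b \<otimes> u" using Cb 4 by blast
      have "x \<otimes> y = b \<otimes> ((w \<otimes> b) \<otimes> z)" using 4 Cc b_closed by (simp add: m_assoc)
      also have "\<dots> = (b \<otimes> b) \<otimes> (u \<otimes> z)" unfolding u using u 4 Cc b_closed by (simp add: m_assoc)
      finally have "x \<otimes> y = u \<otimes> z" using u 4 Cc b_sq by simp
      then show ?thesis using Cm u 4 by auto
    qed
  qed
  have bN: "b \<in> ?N" using C1 b_closed by (metis UnI2 image_eqI r_one)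
  have ib: "inv b = b" using b_sq b_closed by (simp add: inv_equality)
  show "carrier G \<subseteq> ?N"
  proof
    fix x assume "x \<in> carrier G"
    then have "x \<in> generate G {a, b}" by (simp add: generated)
    then show "x \<in> ?N"
    proof (induction rule: generate.induct)
      case one
      then show ?case using C1 by simp
    next
      case (incl h)
      then show ?case using aC bN by auto
    next
      case (inv h)
      then show ?case using iC bN ib by auto
    next
      case (eng h1 h2)
      then show ?case using prod by blast
    qed
  qed
qed

lemma card_cyclic: "card (generate G {a}) = n"
  and refl_disjoint: "generate G {a} \<inter> (\<lambda>x. b \<otimes> x) ` generate G {a} = {}"
proof -
  let ?C = "generate G {a}"
  let ?B = "(\<lambda>x. b \<otimes> x) ` ?C"
  have fin: "finite ?C"
    using finite_carrier normal_form by (metis finite_Un)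
  have co: "card ?C = ord a" using a_closed by (simp add: generate_pow_card)
  have le: "card ?C \<le> n" using co ord_a_dvd n_pos by (simp add: dvd_imp_le)
  have leB: "card ?B \<le> card ?C" using fin by (rule card_image_le)
  have tot: "card (?C \<union> ?B) = 2 * n" using order_eq normal_form by (simp add: Coset.order_def)
  have eq: "card (?C \<union> ?B) + card (?C \<inter> ?B) = card ?C + card ?B"
    using card_Un_Int[of ?C ?B] fin by simp
  show "card ?C = n" using le leB tot eq by linarith
  have "card (?C \<inter> ?B) = 0" using le leB tot eq by linarith
  then show "?C \<inter> ?B = {}" using fin by simp
qed

lemma dihedral_char_rot:
  "dihedral_char G n a h (a [^] (k::nat)) = 2 * cos (2 * real k * real h * pi / real n)"
proof -
  define j where "j = (LEAST j::nat. a [^] k = a [^] j)"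
  have j: "a [^] k = a [^] j" unfolding j_def by (rule LeastI) simp
  have jk: "j \<le> k" unfolding j_def by (rule Least_le) simp
  have "ord a = n" using card_cyclic generate_pow_card[OF a_closed] by simp
  moreover have "a [^] (k - j) = \<one>"
  proof -
    have "a [^] (k - j) \<otimes> a [^] j = \<one> \<otimes> a [^] j"
      using jk j a_closed by (simp add: nat_pow_mult)
    then show ?thesis using a_closed by (metis nat_pow_closed one_closed right_cancel)
  qed
  ultimately have "n dvd k - j" using pow_eq_id[OF a_closed] by simp
  then obtain q where "k - j = n * q" by (auto simp: dvd_def)
  then have k: "k = j + n * q" using jk by simp
  have "2 * real k * real h * pi / real n
      = 2 * real j * real h * pi / real n + real (q * h) * (2 * pi)"
    using n_pos by (simp add: k field_simps)
  moreover have "cos (x + real (m::nat) * (2 * pi)) = cos x" for x m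
    using cos_2npi[of m] sin_2npi[of m] by (simp add: cos_add ac_simps)
  ultimately have "cos (2 * real k * real h * pi / real n) = cos (2 * real j * real h * pi / real n)"
    by (simp only:)
  moreover have "a [^] k \<in> generate G {a}" by (auto simp: cyclic_eq)
  ultimately show ?thesis by (simp add: dihedral_char_def j_def)
qed

lemma dihedral_char_refl: "dihedral_char G n a h (b \<otimes> a [^] (k::nat)) = 0"
  using refl_disjoint by (auto simp: dihedral_char_def cyclic_eq)

end

text \<open>A model for every \<open>n \<ge> 1\<close>; the pair \<open>(e, k)\<close> stands for \<open>b\<^sup>e a\<^sup>k\<close>.\<close>

definition dihedral_model :: "nat \<Rightarrow> (bool \<times> int) monoid" where
  "dihedral_model n =
     \<lparr> carrier = UNIV \<times> {0..<int n},
       monoid.mult = (\<lambda>(e, k) (f, l). (e \<noteq> f, ((if f then - k else k) + l) mod int n)),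
       one = (False, 0) \<rparr>"

lemma group_dihedral_model:
  assumes "n \<ge> 1"
  shows "group (dihedral_model n)"
proof (rule groupI)
  fix x assume "x \<in> carrier (dihedral_model n)"
  then obtain e k where x: "x = (e, k)" "0 \<le> k" "k < int n" by (auto simp: dihedral_model_def)
  define y where "y = (e, (if e then k else - k) mod int n)"
  have "y \<in> carrier (dihedral_model n)" using assms by (auto simp: dihedral_model_def y_def)
  moreover have "y \<otimes>\<^bsub>dihedral_model n\<^esub> x = \<one>\<^bsub>dihedral_model n\<^esub>"
    using x by (auto simp: dihedral_model_def y_def mod_simps)
  ultimately show "\<exists>y\<in>carrier (dihedral_model n). y \<otimes>\<^bsub>dihedral_model n\<^esub> x = \<one>\<^bsub>dihedral_model n\<^esub>"
    by blast
qed (use assms in \<open>auto simp: dihedral_model_def mod_simps algebra_simps\<close>)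

lemma dihedral_group_model:
  assumes n: "n \<ge> 1"
  shows "dihedral_group (dihedral_model n) n (False, 1 mod int n) (True, 0)"
proof -
  let ?M = "dihedral_model n" and ?a = "(False, 1 mod int n)" and ?b = "(True, 0::int)"
  interpret M: group ?M using group_dihedral_model[OF n] .
  have ac: "?a \<in> carrier ?M" and bc: "?b \<in> carrier ?M"
    using n by (auto simp: dihedral_model_def)
  have pow: "?a [^]\<^bsub>?M\<^esub> (k::nat) = (False, int k mod int n)" for k
    by (induction k) (auto simp: dihedral_model_def mod_simps nat_pow_0 nat_pow_Suc add.commute)
  have gen: "generate ?M {?a, ?b} = carrier ?M"
  proof
    show "generate ?M {?a, ?b} \<subseteq> carrier ?M" using ac bc by (intro M.generate_incl) auto
    have powG: "?a [^]\<^bsub>?M\<^esub> (k::nat) \<in> generate ?M {?a, ?b}" for k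
    proof (induction k)
      case 0
      show ?case using generate.one[of ?M] by simp
    next
      case (Suc k)
      then show ?case using generate.eng[OF Suc generate.incl[of ?a]] by simp
    qed
    show "carrier ?M \<subseteq> generate ?M {?a, ?b}"
    proof
      fix x assume "x \<in> carrier ?M"
      then obtain e k where x: "x = (e, k)" "0 \<le> k" "k < int n" by (auto simp: dihedral_model_def)
      have p: "?a [^]\<^bsub>?M\<^esub> nat k = (False, k)" using x by (simp add: pow)
      have "?b \<otimes>\<^bsub>?M\<^esub> (False, k) = (True, k)" using x by (simp add: dihedral_model_def)
      moreover have "(False, k) \<in> generate ?M {?a, ?b}" using powG[of "nat k"] p by simp
      moreover have "?b \<in> generate ?M {?a, ?b}" by (rule generate.incl) simp
      ultimately show "x \<in> generate ?M {?a, ?b}" using x generate.eng by (cases e) fastforce+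
    qed
  qed
  have rel: "?b \<otimes>\<^bsub>?M\<^esub> ?a \<otimes>\<^bsub>?M\<^esub> ?b = inv\<^bsub>?M\<^esub> ?a"
  proof (rule M.inv_equality[symmetric])
    show "?b \<otimes>\<^bsub>?M\<^esub> ?a \<otimes>\<^bsub>?M\<^esub> ?b \<otimes>\<^bsub>?M\<^esub> ?a = \<one>\<^bsub>?M\<^esub>"
      by (simp add: dihedral_model_def mod_simps)
  qed (use ac bc in auto)
  show ?thesis
  proof (unfold_locales)
    show "?a [^]\<^bsub>?M\<^esub> n = \<one>\<^bsub>?M\<^esub>" unfolding pow by (simp add: dihedral_model_def)
    show "?b [^]\<^bsub>?M\<^esub> (2::nat) = \<one>\<^bsub>?M\<^esub>"
      by (simp add: numeral_2_eq_2) (simp add: dihedral_model_def)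
    show "Coset.order ?M = 2 * n"
      by (simp add: Coset.order_def dihedral_model_def card_cartesian_product)
  qed (use n ac bc gen rel in auto)
qed

end

theory Submission
  imports Defs "HOL-Number_Theory.Cong"
begin

text \<open>
  Let \<open>L\<close> and \<open>M\<close> be the Fourier transforms modulo \<open>n\<close> of the sets of exponents of \<open>S1\<close> and \<open>S2\<close>.
  On the functions that are multiples of \<open>j \<mapsto> \<zeta>\<^sup>h\<^sup>j\<close> on the rotations \<open>a\<^sup>j\<close> and of its conjugate
  on the reflections \<open>b a\<^sup>j\<close>, the adjacency operator acts by a \<open>2 \<times> 2\<close> matrix with both diagonal
  entries \<open>L h\<close> and off-diagonal entries \<open>M h\<close> and its conjugate, so the eigenvalues are
  \<open>L h \<plusminus> \<bar>M h\<bar>\<close>. Moreover \<open>2 \<chi>\<^sub>h(S2\<^sup>2) = (2 \<bar>M h\<bar>)\<^sup>2\<close>. As \<open>L h\<close> and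
  \<open>\<bar>M h\<bar>\<^sup>2\<close> are algebraic integers, the graph is integral iff all \<open>L h\<close> are integers and all
  \<open>2 \<chi>\<^sub>h(S2\<^sup>2)\<close> are squares.

  If all \<open>L h\<close> are integers, raise \<open>n 1\<^bsub>S1\<^esub>(a\<^sup>k) = (\<Sum>h. L h \<zeta>\<^sup>-\<^sup>h\<^sup>k)\<close> to the power of a prime
  \<open>p\<close> not dividing \<open>n\<close>: modulo \<open>p\<close> in \<open>\<int>[\<zeta>]\<close> the result is \<open>n 1\<^bsub>S1\<^esub>(a\<^sup>p\<^sup>k)\<close>, so \<open>a\<^sup>k\<close> and \<open>a\<^sup>p\<^sup>k\<close>
  lie both in \<open>S1\<close> or both outside. Hence \<open>S1\<close> is invariant under all exponents coprime to \<open>n\<close>, i.e.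
  it is a union of atoms; irreducibility of cyclotomic polynomials is not needed. Conversely,
  the Fourier transform of an atom is a Ramanujan sum, which is an integer.
\<close>

section \<open>Algebraic integers and the Frobenius congruence\<close>

text \<open>The characteristic polynomial of an integer matrix is monic with integer coefficients,
  and it is compatible with the embedding of the integers into the field.\<close>

lemma algebraic_int_eigenvalue_of_int_mat:
  fixes k :: "'a :: field_char_0"
  assumes A: "A \<in> carrier_mat m m" and ev: "eigenvalue (map_mat of_int A) k"
  shows "algebraic_int k"
proof -
  have "map_mat of_int A \<in> carrier_mat m m" using A by simp
  then have "poly (char_poly (map_mat of_int A)) k = 0"
    using ev eigenvalue_root_char_poly by blast
  then have "poly (map_poly of_int (char_poly A)) k = 0"
    by (simp add: of_int_hom.char_poly_hom[OF A])
  then show ?thesis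
    using degree_monic_char_poly[OF A] algebraic_int_altdef_ipoly by blast
qed

text \<open>
  The powers of \<open>z\<close> span an eigenvector of the integer matrix that describes multiplication by
  \<open>q(z)\<close>; this replaces the closure of the algebraic integers under ring operations.
\<close>

lemma algebraic_int_poly_root_of_unity:
  fixes z :: "'a :: field_char_0"
  assumes z: "z ^ m = 1" and m: "m > 0"
  shows "algebraic_int (poly (map_poly of_int q) z)"
proof -
  \<comment> \<open>Row \<open>i\<close> holds the coefficients of \<open>X^i * q\<close> reduced
    modulo \<open>X^m - 1\<close>, a polynomial that vanishes at \<open>z\<close>.\<close>
  define A where "A = mat m m (\<lambda>(i, j). \<Sum>k\<le>degree q. if (i + k) mod m = j then coeff q k else 0)"
  define v where "v = vec m (\<lambda>j. z ^ j)"
  have A: "A \<in> carrier_mat m m" by (simp add: A_def)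
  have red: "z ^ (i mod m) = z ^ i" for i
    using z by (metis div_mult_mod_eq mult_1 power_add power_mult power_one mult.commute)
  have deg: "degree (map_poly of_int q :: 'a poly) = degree q" by simp
  have "map_mat of_int A *\<^sub>v v = poly (map_poly of_int q) z \<cdot>\<^sub>v v"
  proof (rule eq_vecI)
    fix i assume "i < dim_vec (poly (map_poly of_int q) z \<cdot>\<^sub>v v)"
    then have i: "i < m" by (simp add: v_def)
    have "(map_mat of_int A *\<^sub>v v) $ i
        = (\<Sum>j = 0..<m. (\<Sum>k\<le>degree q. if (i + k) mod m = j then of_int (coeff q k) else 0) * z ^ j)"
      using i by (simp add: A_def v_def scalar_prod_def of_int_hom.hom_sum if_distrib[of of_int] cong: if_cong)
    also have "\<dots> = (\<Sum>j = 0..<m. \<Sum>k\<le>degree q. if (i + k) mod m = j then of_int (coeff q k) * z ^ j else 0)"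
      by (auto simp: sum_distrib_right intro!: sum.cong)
    also have "\<dots> = (\<Sum>k\<le>degree q. \<Sum>j = 0..<m. if (i + k) mod m = j then of_int (coeff q k) * z ^ j else 0)"
      by (rule sum.swap)
    also have "\<dots> = (\<Sum>k\<le>degree q. of_int (coeff q k) * z ^ ((i + k) mod m))"
      using m by (intro sum.cong refl) simp
    also have "\<dots> = (\<Sum>k\<le>degree q. of_int (coeff q k) * z ^ k) * z ^ i"
      unfolding sum_distrib_right by (simp add: red power_add mult_ac)
    also have "\<dots> = poly (map_poly of_int q) z * z ^ i"
      by (simp add: poly_altdef deg)
    finally show "(map_mat of_int A *\<^sub>v v) $ i = (poly (map_poly of_int q) z \<cdot>\<^sub>v v) $ i"
      using i by (simp add: v_def)
  qed (simp add: A_def v_def)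
  moreover have "v \<noteq> 0\<^sub>v m"
  proof
    assume "v = 0\<^sub>v m"
    then have "v $ 0 = 0" using m by simp
    then show False using m by (simp add: v_def)
  qed
  ultimately have "eigenvalue (map_mat of_int A) (poly (map_poly of_int q) z)"
    unfolding eigenvalue_def eigenvector_def using A by (intro exI[of _ v]) (simp add: v_def)
  then show ?thesis using algebraic_int_eigenvalue_of_int_mat[OF A] by blast
qed

text \<open>Modulo \<open>p\<close> only the two outer terms of the binomial expansion survive. The
  ring is general because both integers and integer polynomials occur below.\<close>

lemma prime_dvd_add_power_diff:
  fixes x y :: "'a :: comm_ring_1"
  assumes "prime p"
  shows "of_nat p dvd (x + y) ^ p - x ^ p - y ^ p"
proof -
  have p: "p > 0" using assms prime_gt_0_nat by blast
  have "{..p} = insert 0 (insert p {0<..<p})" using p by auto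
  then have "(x + y) ^ p = y ^ p + x ^ p + (\<Sum>k\<in>{0<..<p}. of_nat (p choose k) * x ^ k * y ^ (p - k))"
    using p by (simp add: binomial_ring)
  moreover have "of_nat p dvd (\<Sum>k\<in>{0<..<p}. of_nat (p choose k) * x ^ k * y ^ (p - k))"
  proof (rule dvd_sum)
    fix k assume "k \<in> {0<..<p}"
    then have "p dvd (p choose k)" using assms by (intro dvd_choose_prime) auto
    then show "of_nat p dvd of_nat (p choose k) * x ^ k * y ^ (p - k)"
      by (metis dvd_mult2 of_nat_mult dvd_def)
  qed
  ultimately show ?thesis by simp
qed

lemma prime_dvd_sum_power_diff:
  fixes f :: "'b \<Rightarrow> 'a :: comm_ring_1"
  assumes p: "prime p" and "finite A"
  shows "of_nat p dvd (\<Sum>i\<in>A. f i) ^ p - (\<Sum>i\<in>A. f i ^ p)"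
  using assms(2)
proof induction
  case empty
  then show ?case using p by (simp add: prime_gt_0_nat zero_power)
next
  case (insert i A)
  have "of_nat p dvd ((f i + (\<Sum>i\<in>A. f i)) ^ p - f i ^ p - (\<Sum>i\<in>A. f i) ^ p)
      + ((\<Sum>i\<in>A. f i) ^ p - (\<Sum>i\<in>A. f i ^ p))"
    using prime_dvd_add_power_diff[OF p] insert.IH by (rule dvd_add)
  then show ?case using insert.hyps by (simp add: algebra_simps)
qed

text \<open>Fermat's little theorem as a case of the Frobenius congruence: a residue
  \<open>m\<close> is a sum of \<open>m\<close> ones, and each one equals its \<open>p\<close>-th
  power.\<close>

lemma prime_dvd_power_diff_int:
  fixes x :: int
  assumes p: "prime p"
  shows "int p dvd x ^ p - x"
proof -
  define m where "m = nat (x mod int p)"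
  have m: "int m = x mod int p" using p by (simp add: m_def prime_gt_0_nat)
  have "int p dvd (\<Sum>i<m. 1) ^ p - (\<Sum>i<m. 1 ^ p)"
    using prime_dvd_sum_power_diff[OF p, of "{..<m}" "\<lambda>_. 1 :: int"] by simp
  then have "int p dvd int m ^ p - int m" by simp
  then have "(int m ^ p) mod int p = int m mod int p" by (simp add: mod_eq_dvd_iff)
  then have "(x ^ p) mod int p = x mod int p" by (simp add: m power_mod)
  then show ?thesis by (simp add: mod_eq_dvd_iff)
qed

text \<open>Modulo \<open>p\<close>, the \<open>p\<close>-th power of an integer polynomial
  substitutes \<open>X^p\<close> for \<open>X\<close>. Staying with polynomials before evaluation
  gives a quotient with integer coefficients, whose value at a root of unity is an algebraic
  integer.\<close>

lemma prime_dvd_poly_power_diff: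
  fixes c :: "'b \<Rightarrow> int" and e :: "'b \<Rightarrow> nat"
  assumes p: "prime p" and A: "finite A"
  shows "of_nat p dvd (\<Sum>i\<in>A. monom (c i) (e i)) ^ p - (\<Sum>i\<in>A. monom (c i) (e i * p))"
proof -
  have mono: "of_nat p dvd monom (c i) (e i) ^ p - monom (c i) (e i * p)" for i
  proof -
    obtain d where d: "c i ^ p - c i = int p * d"
      using prime_dvd_power_diff_int[OF p] by (auto simp: dvd_def)
    have "monom (c i) (e i) ^ p - monom (c i) (e i * p) = monom (c i ^ p - c i) (e i * p)"
      by (simp add: monom_power diff_monom)
    also have "\<dots> = of_nat p * monom d (e i * p)"
      by (simp add: d of_nat_poly smult_monom)
    finally show ?thesis by simp
  qed
  have "of_nat p dvd ((\<Sum>i\<in>A. monom (c i) (e i)) ^ p - (\<Sum>i\<in>A. monom (c i) (e i) ^ p))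
      + (\<Sum>i\<in>A. monom (c i) (e i) ^ p - monom (c i) (e i * p))"
    using prime_dvd_sum_power_diff[OF p A] mono by (intro dvd_add dvd_sum)
  then show ?thesis by (simp add: sum_subtractf)
qed

section \<open>The discrete Fourier transform\<close>

definition zeta :: "nat \<Rightarrow> int \<Rightarrow> complex" where
  "zeta n k = cis (2 * pi * of_int k / real n)"

lemma zeta_0 [simp]: "zeta n 0 = 1"
  by (simp add: zeta_def)

lemma zeta_add: "zeta n (i + j) = zeta n i * zeta n j"
  by (simp add: zeta_def cis_mult ring_distribs add_divide_distrib)

lemma cnj_zeta: "cnj (zeta n k) = zeta n (- k)"
  by (simp add: zeta_def cis_cnj)

lemma zeta_power: "zeta n k ^ m = zeta n (k * int m)"
  by (simp add: zeta_def DeMoivre mult_ac)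

lemma zeta_multiple: "n > 0 \<Longrightarrow> zeta n (int n * k) = 1"
  using cis_multiple_2pi[of "of_int k"] by (simp add: zeta_def mult_ac)

lemma zeta_mod: "n > 0 \<Longrightarrow> zeta n (k mod int n) = zeta n k"
  by (metis zeta_add zeta_multiple mult_div_mod_eq mult_1)

lemma zeta_cong: "n > 0 \<Longrightarrow> i mod int n = j mod int n \<Longrightarrow> zeta n i = zeta n j"
  by (metis zeta_mod)

lemma zeta_eq_1_iff:
  assumes "n > 0"
  shows "zeta n k = 1 \<longleftrightarrow> int n dvd k"
proof
  assume "zeta n k = 1"
  then have "cos (2 * pi * of_int k / real n) = 1" by (simp add: zeta_def complex_eq_iff)
  then obtain m :: int where "2 * pi * of_int k / real n = of_int m * (2 * pi)"
    by (auto simp: cos_one_2pi_int mult_ac)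
  then have "real_of_int k = of_int (m * int n)" using assms by (simp add: field_simps)
  then have "k = m * int n" by (simp only: of_int_eq_iff)
  then show "int n dvd k" by simp
next
  assume "int n dvd k"
  then show "zeta n k = 1" using zeta_multiple[OF assms] by (auto simp: dvd_def)
qed

text \<open>Reduced modulo \<open>n\<close>, the exponents become natural numbers, so the sum is the
  value of an integer polynomial at \<open>zeta n 1\<close>.\<close>

lemma algebraic_int_zeta_sum:
  fixes c :: "'b \<Rightarrow> int"
  assumes "n > 0"
  shows "algebraic_int (\<Sum>x\<in>A. of_int (c x) * zeta n (g x))"
proof -
  define q where "q = (\<Sum>x\<in>A. monom (c x) (nat (g x mod int n)))"
  have "poly (map_poly of_int q) (zeta n 1) = (\<Sum>x\<in>A. of_int (c x) * zeta n 1 ^ nat (g x mod int n))"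
    by (simp add: q_def of_int_poly_hom.hom_sum poly_sum poly_monom)
  also have "\<dots> = (\<Sum>x\<in>A. of_int (c x) * zeta n (g x))"
    using assms by (simp add: zeta_power zeta_mod)
  finally show ?thesis
    using algebraic_int_poly_root_of_unity[of "zeta n 1" n q] assms zeta_multiple[of n 1]
    by (simp add: zeta_power)
qed

lemma sum_periodic_shift:
  fixes f :: "int \<Rightarrow> 'a :: comm_monoid_add"
  assumes "n > 0" and f: "\<And>i. f (i mod int n) = f i"
  shows "(\<Sum>j\<in>{0..<int n}. f (j + c)) = (\<Sum>j\<in>{0..<int n}. f j)"
proof (rule sum.reindex_bij_witness[of _ "\<lambda>j. (j - c) mod int n" "\<lambda>j. (j + c) mod int n"])
qed (use assms in \<open>auto simp: mod_simps\<close>)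

lemma sum_periodic_reflect:
  fixes f :: "int \<Rightarrow> 'a :: comm_monoid_add"
  assumes "n > 0" and f: "\<And>i. f (i mod int n) = f i"
  shows "(\<Sum>j\<in>{0..<int n}. f (c - j)) = (\<Sum>j\<in>{0..<int n}. f j)"
proof (rule sum.reindex_bij_witness[of _ "\<lambda>j. (c - j) mod int n" "\<lambda>j. (c - j) mod int n"])
qed (use assms in \<open>auto simp: mod_simps\<close>)

lemma mod_invariant_dvd:
  fixes d :: int
  assumes "d dvd int n"
  shows "d dvd i mod int n \<longleftrightarrow> d dvd i"
  using assms by (simp add: dvd_mod_iff)

lemma zeta_mult_mod: "n > 0 \<Longrightarrow> zeta n (h * (j mod int n)) = zeta n (h * j)"
  by (rule zeta_cong) (auto simp: mod_simps)

text \<open>Orthogonality of characters on the multiples of \<open>d\<close> modulo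
  \<open>n\<close>: either the character is trivial there, or translation by \<open>d\<close>
  multiplies the sum by a factor other than 1, so that it vanishes.\<close>

lemma sum_zeta_multiples:
  assumes n: "n > 0" and d: "d dvd int n"
  shows "(\<Sum>j\<in>{0..<int n}. of_bool (d dvd j) * zeta n (h * j)) =
    (if int n dvd h * d then of_nat (card {j \<in> {0..<int n}. d dvd j}) else 0)"
proof -
  let ?f = "\<lambda>j. of_bool (d dvd j) * zeta n (h * j)"
  show ?thesis
  proof (cases "int n dvd h * d")
    case True
    have "?f j = of_bool (d dvd j)" for j
      using True by (auto simp: zeta_eq_1_iff[OF n] dvd_def mult_ac)
    then show ?thesis using True by (simp add: Int_def)
  next
    case False
    have "(\<Sum>j\<in>{0..<int n}. ?f j) = (\<Sum>j\<in>{0..<int n}. ?f (j + d))"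
      by (rule sum_periodic_shift[symmetric])
        (use n d in \<open>simp_all add: mod_invariant_dvd zeta_mult_mod\<close>)
    also have "\<dots> = zeta n (h * d) * (\<Sum>j\<in>{0..<int n}. ?f j)"
      by (simp add: sum_distrib_left ring_distribs zeta_add mult_ac)
    finally have "(\<Sum>j\<in>{0..<int n}. ?f j) = 0"
      using False by (simp add: zeta_eq_1_iff[OF n])
    then show ?thesis using False by simp
  qed
qed

lemma sum_zeta:
  assumes n: "n > 0"
  shows "(\<Sum>j\<in>{0..<int n}. zeta n (h * j)) = (if int n dvd h then of_nat n else 0)"
proof -
  have "{j \<in> {0..<int n}. 1 dvd j} = {0..<int n}" by auto
  then show ?thesis using sum_zeta_multiples[OF n, of 1 h] by simp
qed

definition dft :: "nat \<Rightarrow> (int \<Rightarrow> complex) \<Rightarrow> int \<Rightarrow> complex" where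
  "dft n f h = (\<Sum>j\<in>{0..<int n}. f j * zeta n (h * j))"

lemma dft_mod: "n > 0 \<Longrightarrow> dft n f (h mod int n) = dft n f h"
  unfolding dft_def by (intro sum.cong refl arg_cong2[of _ _ _ _ "(*)"] zeta_cong) (auto simp: mod_simps)

lemma dft_inversion:
  assumes n: "n > 0" and k: "k \<in> {0..<int n}"
  shows "(\<Sum>h\<in>{0..<int n}. dft n f h * zeta n (- k * h)) = of_nat n * f k"
proof -
  have e: "zeta n (h * j) * zeta n (- k * h) = zeta n ((j - k) * h)" for h j
    by (simp add: zeta_add[symmetric] algebra_simps)
  have "(\<Sum>h\<in>{0..<int n}. dft n f h * zeta n (- k * h))
      = (\<Sum>h\<in>{0..<int n}. \<Sum>j\<in>{0..<int n}. f j * zeta n ((j - k) * h))"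
    unfolding dft_def sum_distrib_right mult.assoc e ..
  also have "\<dots> = (\<Sum>j\<in>{0..<int n}. f j * (\<Sum>h\<in>{0..<int n}. zeta n ((j - k) * h)))"
    by (subst sum.swap) (simp add: sum_distrib_left)
  also have "\<dots> = (\<Sum>j\<in>{0..<int n}. if j = k then of_nat n * f k else 0)"
  proof (intro sum.cong refl)
    fix j assume j: "j \<in> {0..<int n}"
    have "int n dvd j - k \<longleftrightarrow> j = k"
      using j k by (auto simp: mod_eq_dvd_iff[symmetric])
    then show "f j * (\<Sum>h\<in>{0..<int n}. zeta n ((j - k) * h)) = (if j = k then of_nat n * f k else 0)"
      by (simp add: sum_zeta[OF n])
  qed
  also have "\<dots> = of_nat n * f k" using k by simp
  finally show ?thesis .
qed

section \<open>From integral transforms to invariance under units modulo \<open>n\<close>\<close>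

lemma int_dft_imp_prime_invariant:
  assumes n: "n > 0" and P: "\<And>i. P (i mod int n) = P i"
    and ints: "\<And>h. dft n (\<lambda>j. of_bool (P j)) h \<in> \<int>"
    and p: "prime p" "\<not> p dvd n"
  shows "P (int p * k) = P k"
proof -
  let ?N = "{0..<int n}"
  have "\<exists>m. dft n (\<lambda>j. of_bool (P j)) h = of_int m" for h
    using ints[of h] by (auto elim: Ints_cases)
  then obtain l where l: "\<And>h. dft n (\<lambda>j. of_bool (P j)) h = of_int (l h)"
    by metis
  have inv: "(\<Sum>h\<in>?N. of_int (l h) * zeta n (- k * h)) = of_nat n * of_bool (P k)" for k
  proof -
    have "(\<Sum>h\<in>?N. of_int (l h) * zeta n (- k * h))
        = (\<Sum>h\<in>?N. of_int (l h) * zeta n (- (k mod int n) * h))"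
    proof (intro sum.cong refl arg_cong2[of _ _ _ _ "(*)"] zeta_cong n)
      show "- k * h mod int n = - (k mod int n) * h mod int n" for h
        by (metis mod_minus_eq mod_mult_left_eq)
    qed
    also have "\<dots> = of_nat n * of_bool (P (k mod int n))"
      unfolding l[symmetric] by (rule dft_inversion) (use n in auto)
    finally show ?thesis by (simp add: P)
  qed
  \<comment> \<open>At \<open>z = zeta n (- k)\<close> the value of \<open>R\<close> is the
    inversion sum for \<open>k\<close>, and that of \<open>R'\<close> is the inversion sum for
    \<open>p * k\<close>.\<close>
  define R where "R = (\<Sum>h\<in>?N. monom (l h) (nat h))"
  define R' where "R' = (\<Sum>h\<in>?N. monom (l h) (nat h * p))"
  obtain q where q: "R ^ p - R' = of_nat p * q"
    using prime_dvd_poly_power_diff[OF p(1), of ?N l nat] unfolding R_def R'_def by auto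
  define z where "z = zeta n (- k)"
  let ?ev = "\<lambda>q. poly (map_poly of_int q) z"
  have ev: "?ev (\<Sum>h\<in>?N. monom (l h) (e h)) = (\<Sum>h\<in>?N. of_int (l h) * z ^ e h)" for e
    by (simp add: of_int_poly_hom.hom_sum poly_sum poly_monom)
  have "?ev R = of_nat n * of_bool (P k)"
    unfolding R_def ev inv[symmetric] by (intro sum.cong refl) (auto simp: z_def zeta_power)
  moreover have "?ev R' = of_nat n * of_bool (P (int p * k))"
    unfolding R'_def ev inv[symmetric]
    by (intro sum.cong refl) (auto simp: z_def zeta_power mult_ac)
  moreover have "?ev (R ^ p - R') = ?ev R ^ p - ?ev R'"
    by (simp add: of_int_poly_hom.hom_minus of_int_poly_hom.hom_power)
  moreover have "?ev (of_nat p * q) = ?ev (of_nat p) * ?ev q"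
    by (simp only: of_int_poly_hom.hom_mult poly_mult)
  moreover have "?ev (of_nat p) = of_nat p"
    by (simp add: of_nat_poly poly_altdef)
  ultimately have key: "(of_nat n * of_bool (P k)) ^ p - of_nat n * of_bool (P (int p * k)) = of_nat p * ?ev q"
    using q by simp
  \<comment> \<open>This is the left side of \<open>key\<close> as an integer. Its quotient by
    \<open>p\<close> is rational and also an algebraic integer, hence an integer.\<close>
  define D where "D = (int n * of_bool (P k)) ^ p - int n * of_bool (P (int p * k))"
  have "(of_int D :: complex) = (of_nat n * of_bool (P k)) ^ p - of_nat n * of_bool (P (int p * k))"
    by (simp add: D_def)
  then have D: "of_int D = of_nat p * ?ev q" using key by simp
  then have "?ev q = of_int D / of_nat p" using p by (simp add: prime_gt_0_nat)
  then have "?ev q \<in> \<rat>" by simp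
  moreover have "z ^ n = 1"
    using zeta_multiple[OF n, of "- k"] by (simp add: z_def zeta_power mult_ac)
  then have "algebraic_int (?ev q)" using n algebraic_int_poly_root_of_unity by blast
  ultimately obtain m where m: "?ev q = of_int m"
    using rational_algebraic_int_is_int by (auto elim: Ints_cases)
  have "(of_int D :: complex) = of_int (int p * m)" using D m by simp
  then have dvd: "int p dvd D" by (simp only: of_int_eq_iff) simp
  show ?thesis
  proof (rule ccontr)
    assume "P (int p * k) \<noteq> P k"
    \<comment> \<open>With different truth values exactly one term of \<open>D\<close> remains, and
      \<open>p\<close> divides neither \<open>n ^ p\<close> nor \<open>- n\<close>.\<close>
    then have "D = int n ^ p \<or> D = - int n" using p by (auto simp: D_def prime_gt_0_nat)
    then have "int p dvd int n"
      using dvd p by (auto simp: prime_dvd_power_iff prime_gt_0_nat dest: prime_dvd_power)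
    then show False using p by simp
  qed
qed

lemma int_dft_imp_coprime_invariant:
  assumes n: "n > 0" and P: "\<And>i. P (i mod int n) = P i"
    and ints: "\<And>h. dft n (\<lambda>j. of_bool (P j)) h \<in> \<int>"
    and m: "Rings.coprime m n"
  shows "P (int m * k) = P k"
  using m
proof (induction m arbitrary: k rule: prime_divisors_induct)
  case zero
  \<comment> \<open>Coprimality with 0 forces \<open>n = 1\<close>, where all exponents are
    congruent.\<close>
  then have "n = 1" by simp
  then show ?case using P by (metis mod_by_1 of_nat_1)
next
  case (unit m)
  then show ?case by simp
next
  case (factor p m)
  then have "P (int p * (int m * k)) = P (int m * k)"
    using int_dft_imp_prime_invariant[OF n P ints] by (metis coprime_mult_left_iff coprime_absorb_left not_prime_unit)
  then show ?case using factor by (simp add: mult_ac)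
qed

text \<open>With \<open>t\<close> the product of the primes of \<open>n\<close> that do not divide
  \<open>m\<close>, every prime of \<open>n\<close> divides exactly one of \<open>m\<close> and
  \<open>t * e\<close>, hence not their sum.\<close>

lemma exists_coprime_lift:
  fixes m e n :: nat
  assumes "n > 0" "Rings.coprime m e"
  shows "\<exists>t. Rings.coprime (m + t * e) n"
proof -
  define t where "t = \<Prod>{p \<in> prime_factors n. \<not> p dvd m}"
  have "\<not> p dvd m + t * e" if p: "prime p" "p dvd n" for p
  proof (cases "p dvd m")
    case True
    then have "\<not> p dvd e" using assms(2) p by (metis coprime_common_divisor not_prime_unit)
    moreover have "\<not> p dvd t"
      unfolding t_def using p True
      by (auto simp: prime_dvd_prod_iff) (metis prime_factors_dvd in_prime_factors_iff primes_dvd_imp_eq)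
    ultimately show ?thesis using True p by (simp add: dvd_add_right_iff prime_dvd_mult_iff)
  next
    case False
    then have "p \<in> {p \<in> prime_factors n. \<not> p dvd m}"
      using p assms by (simp add: in_prime_factors_iff)
    then have "p dvd t" unfolding t_def by (intro dvd_prodI) auto
    then show ?thesis using False by (simp add: dvd_add_left_iff)
  qed
  then have "gcd (m + t * e) n = 1"
    using prime_factor_nat[of "gcd (m + t * e) n"] by auto
  then have "Rings.coprime (m + t * e) n" by (simp add: coprime_iff_gcd_eq_1)
  then show ?thesis by blast
qed

text \<open>Residues with equal gcd form one orbit under the units modulo \<open>n\<close>. After
  division by the common gcd \<open>d\<close>, both \<open>i'\<close> and \<open>j'\<close> are
  units modulo \<open>e = n / d\<close>, and their quotient lifts to a unit modulo
  \<open>n\<close>.\<close>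

lemma eq_gcd_imp_coprime_multiple:
  fixes i j :: int
  assumes n: "n > 0" and eq: "gcd i (int n) = gcd j (int n)"
  shows "\<exists>m. Rings.coprime m n \<and> j mod int n = (int m * i) mod int n"
proof -
  define d where "d = gcd i (int n)"
  have d: "d > 0" using n by (simp add: d_def)
  obtain i' e where i: "i = d * i'" and e: "int n = d * e" and c: "Rings.coprime i' e"
  proof -
    have "gcd i (int n) \<noteq> 0" using d by (simp add: d_def)
    from gcd_coprime_exists[OF this] that show ?thesis
      unfolding d_def[symmetric] by (metis mult.commute)
  qed
  have "d dvd j" using eq by (metis d_def gcd_dvd1)
  then obtain j' where j: "j = d * j'" by (auto simp: dvd_def)
  have "d = gcd j (int n)" using eq by (simp add: d_def)
  then have "d = gcd (d * j') (d * e)" by (simp only: e j)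
  then have c': "Rings.coprime j' e" using d by (simp add: gcd_mult_left coprime_iff_gcd_eq_1)
  have e0: "e > 0" using e n d by (metis of_nat_0_less_iff zero_less_mult_pos)
  obtain x where x: "[i' * x = 1] (mod e)" using c cong_solve_coprime_int by blast
  \<comment> \<open>\<open>m0\<close> solves the congruence but is only known to be coprime to
    \<open>e\<close>. Adding a multiple of \<open>e\<close> makes it coprime to \<open>n\<close> and
    keeps it a solution.\<close>
  define m0 where "m0 = nat ((x * j') mod e)"
  have m0: "int m0 = (x * j') mod e" using e0 by (simp add: m0_def)
  have "Rings.coprime x e" using x by (metis coprime_iff_invertible_int mult.commute)
  then have "Rings.coprime (x * j') e" using c' by simp
  then have "Rings.coprime ((x * j') mod e) e" using e0 by (simp add: coprime_iff_gcd_eq_1)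
  then have "Rings.coprime m0 (nat e)" 
    using e0 by (metis m0 coprime_int_iff int_nat_eq less_imp_le)
  then obtain t where t: "Rings.coprime (m0 + t * nat e) n" using exists_coprime_lift n by blast
  have "[int (m0 + t * nat e) = x * j'] (mod e)"
    using e0 by (simp add: m0 cong_def)
  then have "[int (m0 + t * nat e) * i' = (x * j') * i'] (mod e)"
    by (rule cong_scalar_right)
  also have "[(x * j') * i' = j'] (mod e)"
    using cong_scalar_right[OF x, of j'] by (simp add: mult_ac)
  finally have "e dvd int (m0 + t * nat e) * i' - j'" by (simp add: cong_iff_dvd_diff)
  then have "d * e dvd d * (int (m0 + t * nat e) * i' - j')" by (rule mult_dvd_mono[OF dvd_refl])
  then have "int n dvd int (m0 + t * nat e) * i - j" by (simp add: e i j algebra_simps)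
  then show ?thesis using t by (metis mod_eq_dvd_iff)
qed

text \<open>This expresses a union of atoms through exponents: \<open>a^i\<close> and
  \<open>a^j\<close> generate the same subgroup iff the two gcds agree.\<close>

definition gcd_invariant :: "nat \<Rightarrow> (int \<Rightarrow> bool) \<Rightarrow> bool" where
  "gcd_invariant n P \<longleftrightarrow> (\<forall>i j. gcd i (int n) = gcd j (int n) \<longrightarrow> P i = P j)"

lemma int_dft_imp_gcd_invariant:
  assumes n: "n > 0" and P: "\<And>i. P (i mod int n) = P i"
    and ints: "\<And>h. dft n (\<lambda>j. of_bool (P j)) h \<in> \<int>"
  shows "gcd_invariant n P"
  unfolding gcd_invariant_def
proof (intro allI impI)
  fix i j :: int assume "gcd i (int n) = gcd j (int n)"
  then obtain m where "Rings.coprime m n" "j mod int n = (int m * i) mod int n"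
    using eq_gcd_imp_coprime_multiple[OF n] by blast
  then show "P i = P j"
    using int_dft_imp_coprime_invariant[OF n P ints] P by metis
qed

text \<open>Downward induction on \<open>d\<close>: the sum over all multiples of \<open>d\<close>
  is an integer by orthogonality, and it splits by gcd into the wanted sum and sums for larger
  divisors of \<open>n\<close>.\<close>

lemma ramanujan_sum_int:
  fixes d :: int
  assumes n: "n > 0" and "d dvd int n" "d > 0"
  shows "(\<Sum>j | j \<in> {0..<int n} \<and> gcd j (int n) = d. zeta n (h * j)) \<in> \<int>"
  using assms(2,3)
proof (induction "nat (int n - d)" arbitrary: d rule: less_induct)
  case less
  let ?c = "\<lambda>d. \<Sum>j | j \<in> {0..<int n} \<and> gcd j (int n) = d. zeta n (h * j)"
  define J where "J = {j \<in> {0..<int n}. d dvd j}"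
  define E where "E = (\<lambda>j. gcd j (int n)) ` J"
  have "finite J" by (auto simp: J_def intro: finite_subset[of _ "{0..<int n}"])
  then have fin: "finite J" "finite E" by (simp_all add: E_def)
  have E: "d dvd e" "e dvd int n" "e > 0" if "e \<in> E" for e
    using that less.prems n by (auto simp: E_def J_def)
  have fib: "{j \<in> J. gcd j (int n) = e} = {j. j \<in> {0..<int n} \<and> gcd j (int n) = e}" if "e \<in> E" for e
    using E(1)[OF that] by (auto simp: J_def)
  \<comment> \<open>The reduction matters for \<open>d = n\<close>, which lies outside the index
    range and is represented by 0.\<close>
  have "gcd (d mod int n) (int n) = d" using less.prems by (simp add: gcd.commute gcd_red_int[symmetric] zdvd_imp_le)
  then have dE: "d \<in> E" unfolding E_def J_def
    using n less.prems by (intro image_eqI[of _ _ "d mod int n"]) (auto simp: mod_invariant_dvd)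
  have "(\<Sum>j\<in>J. zeta n (h * j)) = (\<Sum>j\<in>{0..<int n}. of_bool (d dvd j) * zeta n (h * j))"
    by (simp add: J_def Int_def)
  then have total: "(\<Sum>j\<in>J. zeta n (h * j)) \<in> \<int>"
    using sum_zeta_multiples[OF n less.prems(1)] by simp
  have "(\<Sum>j\<in>J. zeta n (h * j)) = (\<Sum>e\<in>E. ?c e)"
    using sum.image_gen[OF fin(1), of "\<lambda>j. zeta n (h * j)" "\<lambda>j. gcd j (int n)"] fib
    by (simp add: E_def)
  also have "\<dots> = ?c d + (\<Sum>e\<in>E - {d}. ?c e)"
    by (rule sum.remove[OF fin(2) dE])
  finally have "?c d = (\<Sum>j\<in>J. zeta n (h * j)) - (\<Sum>e\<in>E - {d}. ?c e)" by simp
  moreover have "(\<Sum>e\<in>E - {d}. ?c e) \<in> \<int>"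
  proof (rule Ints_sum)
    fix e assume e: "e \<in> E - {d}"
    then have "d < e" using E zdvd_imp_le[of d e] by fastforce
    moreover have "e \<le> int n" using E e n by (simp add: zdvd_imp_le)
    ultimately show "?c e \<in> \<int>" using E e by (intro less.hyps) auto
  qed
  ultimately show ?case using Ints_diff[OF total] by simp
qed

lemma gcd_invariant_imp_int_dft:
  assumes n: "n > 0" and P: "gcd_invariant n P"
  shows "dft n (\<lambda>j. of_bool (P j)) h \<in> \<int>"
proof -
  let ?g = "\<lambda>j. gcd j (int n)"
  have "dft n (\<lambda>j. of_bool (P j)) h
      = (\<Sum>d\<in>?g ` {0..<int n}. \<Sum>j | j \<in> {0..<int n} \<and> ?g j = d. of_bool (P j) * zeta n (h * j))"
    unfolding dft_def by (rule sum.image_gen) simp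
  also have "\<dots> = (\<Sum>d\<in>?g ` {0..<int n}. of_bool (P d) * (\<Sum>j | j \<in> {0..<int n} \<and> ?g j = d. zeta n (h * j)))"
    unfolding sum_distrib_left
  proof (intro sum.cong refl)
    fix d j assume "j \<in> {j. j \<in> {0..<int n} \<and> ?g j = d}"
    \<comment> \<open>As a divisor of \<open>n\<close>, \<open>d\<close> lies in its own gcd class,
      so \<open>P d\<close> is the common truth value there.\<close>
    then have "gcd j (int n) = gcd d (int n)" by auto
    then have "P j = P d" using P unfolding gcd_invariant_def by blast
    then show "of_bool (P j) * zeta n (h * j) = of_bool (P d) * zeta n (h * j)" by simp
  qed
  also have "\<dots> \<in> \<int>"
    using n by (intro Ints_sum Ints_mult ramanujan_sum_int) auto
  finally show ?thesis .
qed

section \<open>Atoms of the subgroup algebra\<close>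

text \<open>The extra member \<open>A0\<close> covers the empty family, whose intersection is the
  whole type.\<close>

lemma subgroup_algebra_Inter:
  assumes "finite F" "\<And>A. A \<in> F \<Longrightarrow> A \<in> subgroup_algebra C" "A0 \<in> subgroup_algebra C"
  shows "A0 \<inter> \<Inter>F \<in> subgroup_algebra C"
  using assms
proof (induction F)
  case (insert A F)
  have "A \<inter> (A0 \<inter> \<Inter>F) \<in> subgroup_algebra C"
    by (rule subgroup_algebra.inter) (use insert in auto)
  then show ?case by (simp add: Int_left_commute)
qed simp

lemma subgroup_algebra_Union:
  assumes "finite F" "\<And>A. A \<in> F \<Longrightarrow> A \<in> subgroup_algebra C" "A0 \<in> subgroup_algebra C"
  shows "A0 \<union> \<Union>F \<in> subgroup_algebra C"
  using assms
proof (induction F)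
  case (insert A F)
  have "A \<union> (A0 \<union> \<Union>F) \<in> subgroup_algebra C"
    by (rule subgroup_algebra.union) (use insert in auto)
  then show ?case by (simp add: Un_left_commute)
qed simp

text \<open>Sets that do not separate points lying in the same subgroups are closed under the
  Boolean operations. Conversely, such a set is the finite union of the atoms of its points, each a
  finite intersection of subgroups and complements.\<close>

lemma (in group) subgroup_algebra_iff:
  assumes fin: "finite (carrier G)"
  shows "A \<in> subgroup_algebra G \<longleftrightarrow> A \<subseteq> carrier G \<and>
    (\<forall>x\<in>carrier G. \<forall>y\<in>carrier G. (\<forall>H. subgroup H G \<longrightarrow> (x \<in> H \<longleftrightarrow> y \<in> H)) \<longrightarrow> (x \<in> A \<longleftrightarrow> y \<in> A))"
    (is "_ \<longleftrightarrow> ?R A")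
proof
  assume "A \<in> subgroup_algebra G"
  then show "?R A"
  proof induction
    case (subgroup H)
    then show ?case using subgroup.subset by blast
  next
    case (union A B)
    then show ?case by blast
  next
    case (inter A B)
    then show ?case by blast
  next
    case (compl A)
    then show ?case by blast
  qed
next
  assume R: "?R A"
  have top: "carrier G \<in> subgroup_algebra G" by (rule subgroup_algebra.subgroup[OF subgroup_self])
  have bot: "{} \<in> subgroup_algebra G" using subgroup_algebra.compl[OF top] by simp
  define atom where "atom x = carrier G \<inter> \<Inter>{B. B \<subseteq> carrier G \<and> x \<in> B \<and>
    (subgroup B G \<or> (\<exists>H. subgroup H G \<and> B = carrier G - H))}" for x
  have atom: "atom x \<in> subgroup_algebra G" for x
    unfolding atom_def
  proof (rule subgroup_algebra_Inter)
    show "finite {B. B \<subseteq> carrier G \<and> x \<in> B \<and> (subgroup B G \<or> (\<exists>H. subgroup H G \<and> B = carrier G - H))}"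
      by (rule finite_subset[of _ "Pow (carrier G)"]) (use fin in auto)
  qed (use top in \<open>auto intro: subgroup_algebra.intros\<close>)
  have mem: "x \<in> atom x" if "x \<in> carrier G" for x
    using that by (auto simp: atom_def)
  have sub: "atom x \<subseteq> A" if x: "x \<in> A" for x
  proof
    fix y assume y: "y \<in> atom x"
    have c: "x \<in> carrier G" "y \<in> carrier G" using R x y by (auto simp: atom_def)
    have y_mem: "y \<in> B" if "B \<subseteq> carrier G" "x \<in> B"
      "subgroup B G \<or> (\<exists>H. subgroup H G \<and> B = carrier G - H)" for B
      using y that unfolding atom_def by blast
    \<comment> \<open>The complement of \<open>H\<close> supplies the direction from
      \<open>y\<close> to \<open>x\<close>.\<close>
    have "x \<in> H \<longleftrightarrow> y \<in> H" if H: "subgroup H G" for H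
      using y_mem[of H] y_mem[of "carrier G - H"] H subgroup.subset[OF H] c by auto
    then show "y \<in> A" using R x c by blast
  qed
  have "{} \<union> \<Union>(atom ` A) \<in> subgroup_algebra G"
    using R fin bot atom by (intro subgroup_algebra_Union) (auto intro: finite_subset)
  moreover have "{} \<union> \<Union>(atom ` A) = A" using R mem sub by blast
  ultimately show "A \<in> subgroup_algebra G" by simp
qed

section \<open>Spectrum of the Cayley graph\<close>

text \<open>This trades the vertex ordering for functions on the vertices, so that the spectrum can
  be computed in group coordinates.\<close>

lemma eigenvalue_adjacency_matrix_iff:
  assumes vs: "distinct vs" "set vs = pverts X"
  shows "eigenvalue (adjacency_matrix X vs) k \<longleftrightarrow>
    (\<exists>f. (\<exists>x\<in>pverts X. f x \<noteq> 0) \<and>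
      (\<forall>x\<in>pverts X. (\<Sum>y\<in>pverts X. of_bool ((x, y) \<in> parcs X) * f y) = k * f x))"
proof -
  let ?A = "adjacency_matrix X vs" and ?m = "length vs"
  have fin: "finite (pverts X)" using vs by (metis List.finite_set)
  have bij: "bij_betw (\<lambda>i. vs ! i) {0..<?m} (pverts X)"
    using bij_betw_nth[OF vs(1)] vs(2) by (simp add: lessThan_atLeast0)
  have A: "?A \<in> carrier_mat ?m ?m" by (simp add: adjacency_matrix_def)
  have mult: "(?A *\<^sub>v v) $ i = (\<Sum>y\<in>pverts X. of_bool ((vs ! i, y) \<in> parcs X) * f y)"
    if "i < ?m" "v \<in> carrier_vec ?m" "\<And>j. j < ?m \<Longrightarrow> v $ j = f (vs ! j)" for i v f
  proof -
    have "(?A *\<^sub>v v) $ i = (\<Sum>j\<in>{0..<?m}. of_bool ((vs ! i, vs ! j) \<in> parcs X) * f (vs ! j))"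
      using that by (simp add: adjacency_matrix_def scalar_prod_def of_bool_def)
    also have "\<dots> = (\<Sum>y\<in>pverts X. of_bool ((vs ! i, y) \<in> parcs X) * f y)"
      by (rule sum.reindex_bij_betw[OF bij])
    finally show ?thesis .
  qed
  show ?thesis
  proof
    assume "eigenvalue ?A k"
    then obtain v where v: "v \<in> carrier_vec ?m" "v \<noteq> 0\<^sub>v ?m" "?A *\<^sub>v v = k \<cdot>\<^sub>v v"
      using A by (auto simp: eigenvalue_def eigenvector_def)
    define f where "f x = v $ (the_inv_into {0..<?m} (\<lambda>i. vs ! i) x)" for x
    have f: "f (vs ! j) = v $ j" if "j < ?m" for j
      using the_inv_into_f_f[OF bij_betw_imp_inj_on[OF bij], of j] that by (simp add: f_def)
    have "\<exists>j. j < ?m \<and> v $ j \<noteq> 0"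
    proof (rule ccontr)
      assume "\<not> (\<exists>j. j < ?m \<and> v $ j \<noteq> 0)"
      then have "v = 0\<^sub>v ?m" using v(1) by (intro eq_vecI) auto
      then show False using v(2) by simp
    qed
    then obtain j where "j < ?m" "v $ j \<noteq> 0" by blast
    then have "vs ! j \<in> pverts X" "f (vs ! j) \<noteq> 0" using f vs(2) by auto
    then have "\<exists>x\<in>pverts X. f x \<noteq> 0" by blast
    moreover have "(\<Sum>y\<in>pverts X. of_bool ((x, y) \<in> parcs X) * f y) = k * f x" if "x \<in> pverts X" for x
    proof -
      have "x \<in> set vs" using that by (simp add: vs(2))
      then obtain i where i: "i < ?m" "x = vs ! i" by (auto simp: in_set_conv_nth)
      have "(?A *\<^sub>v v) $ i = (\<Sum>y\<in>pverts X. of_bool ((vs ! i, y) \<in> parcs X) * f y)"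
        by (rule mult) (use i v f in auto)
      then show ?thesis using i v f by simp
    qed
    ultimately show "\<exists>f. (\<exists>x\<in>pverts X. f x \<noteq> 0) \<and>
      (\<forall>x\<in>pverts X. (\<Sum>y\<in>pverts X. of_bool ((x, y) \<in> parcs X) * f y) = k * f x)" by blast
  next
    assume "\<exists>f. (\<exists>x\<in>pverts X. f x \<noteq> 0) \<and>
      (\<forall>x\<in>pverts X. (\<Sum>y\<in>pverts X. of_bool ((x, y) \<in> parcs X) * f y) = k * f x)"
    then obtain f x where x: "x \<in> pverts X" "f x \<noteq> 0"
      and f: "\<And>x. x \<in> pverts X \<Longrightarrow> (\<Sum>y\<in>pverts X. of_bool ((x, y) \<in> parcs X) * f y) = k * f x"
      by blast
    define v where "v = vec ?m (\<lambda>i. f (vs ! i))"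
    have v: "v \<in> carrier_vec ?m" by (simp add: v_def)
    obtain i where i: "i < ?m" "x = vs ! i" using x(1) vs(2) by (metis in_set_conv_nth)
    then have "v $ i \<noteq> 0\<^sub>v ?m $ i" using x(2) by (simp add: v_def)
    then have "v \<noteq> 0\<^sub>v ?m" by metis
    moreover have "?A *\<^sub>v v = k \<cdot>\<^sub>v v"
    proof (rule eq_vecI)
      fix i assume "i < dim_vec (k \<cdot>\<^sub>v v)"
      then have i: "i < ?m" by (simp add: v_def)
      have "(?A *\<^sub>v v) $ i = (\<Sum>y\<in>pverts X. of_bool ((vs ! i, y) \<in> parcs X) * f y)"
        by (rule mult) (use i in \<open>auto simp: v_def\<close>)
      also have "\<dots> = k * f (vs ! i)" using f i vs(2) by (metis nth_mem)
      finally show "(?A *\<^sub>v v) $ i = (k \<cdot>\<^sub>v v) $ i" using i by (simp add: v_def)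
    qed (simp add: adjacency_matrix_def v_def)
    ultimately show "eigenvalue ?A k"
      unfolding eigenvalue_def eigenvector_def using v A by (intro exI[of _ v]) simp
  qed
qed

lemma sum_shift_zeta:
  assumes n: "n > 0" and Q: "\<And>i. Q (i mod int n) = Q i"
  shows "(\<Sum>i\<in>{0..<int n}. of_bool (Q (i + c)) * zeta n (h * i))
    = zeta n (- h * c) * dft n (\<lambda>j. of_bool (Q j)) h"
proof -
  let ?f = "\<lambda>i. of_bool (Q i) * (zeta n (- h * c) * zeta n (h * i))"
  have "of_bool (Q (i + c)) * zeta n (h * i) = ?f (i + c)" for i
    by (simp add: zeta_add[symmetric] algebra_simps)
  then have "(\<Sum>i\<in>{0..<int n}. of_bool (Q (i + c)) * zeta n (h * i)) = (\<Sum>i\<in>{0..<int n}. ?f (i + c))"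
    by simp
  also have "\<dots> = (\<Sum>i\<in>{0..<int n}. ?f i)"
    by (rule sum_periodic_shift) (simp_all add: n Q zeta_mult_mod)
  finally show ?thesis by (simp add: dft_def sum_distrib_left mult_ac)
qed

lemma dft_uminus_of_bool: "dft n (\<lambda>j. of_bool (Q j)) (- h) = cnj (dft n (\<lambda>j. of_bool (Q j)) h)"
  by (simp add: dft_def cnj_zeta)

lemma dft_uminus_of_bool_even:
  assumes n: "n > 0" and P: "\<And>i. P (i mod int n) = P i" "\<And>i. P (- i) = P i"
  shows "dft n (\<lambda>j. of_bool (P j)) (- h) = dft n (\<lambda>j. of_bool (P j)) h"
proof -
  let ?f = "\<lambda>i. of_bool (P i) * zeta n (h * i)"
  have "(\<Sum>i\<in>{0..<int n}. ?f (0 - i)) = (\<Sum>i\<in>{0..<int n}. ?f i)"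
    by (rule sum_periodic_reflect) (simp_all add: n P zeta_mult_mod)
  then show ?thesis by (simp add: dft_def P)
qed

text \<open>Here \<open>u\<close> and \<open>v\<close> are the values of a function on rotations and
  on reflections. The Fourier transform splits the system into \<open>2 \<times> 2\<close> blocks
  with characteristic equation \<open>(k - L h)\<^sup>2 = M h * cnj (M h)\<close>.\<close>

lemma eigenfunction_iff:
  fixes k :: complex
  assumes n: "n > 0" and P: "\<And>i. P (i mod int n) = P i" "\<And>i. P (- i) = P i"
    and Q: "\<And>i. Q (i mod int n) = Q i"
  defines "N \<equiv> {0..<int n}"
    and "L \<equiv> dft n (\<lambda>j. of_bool (P j))" and "M \<equiv> dft n (\<lambda>j. of_bool (Q j))"
  shows "(\<exists>u v. (\<exists>i\<in>N. u i \<noteq> 0 \<or> v i \<noteq> 0) \<and>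
      (\<forall>i\<in>N. (\<Sum>j\<in>N. of_bool (P (j - i)) * u j) + (\<Sum>j\<in>N. of_bool (Q (i + j)) * v j) = k * u i) \<and>
      (\<forall>i\<in>N. (\<Sum>j\<in>N. of_bool (Q (i + j)) * u j) + (\<Sum>j\<in>N. of_bool (P (j - i)) * v j) = k * v i))
    \<longleftrightarrow> (\<exists>h. (k - L h)\<^sup>2 = (of_real (cmod (M h)))\<^sup>2)" (is "(\<exists>u v. ?E u v) \<longleftrightarrow> _")
proof -
  have Lm: "L (- h) = L h" and Mm: "M (- h) = cnj (M h)" for h
    unfolding L_def M_def using dft_uminus_of_bool_even[where P = P, OF n P] dft_uminus_of_bool by blast+
  have norm: "M h * cnj (M h) = (of_real (cmod (M h)))\<^sup>2" for h
    by (simp add: complex_norm_square[symmetric])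
  have sumQ: "(\<Sum>j\<in>N. of_bool (Q (i + j)) * zeta n (h * j)) = zeta n (- h * i) * M h" for i h
    using sum_shift_zeta[where Q = Q and c = i and h = h, OF n Q] by (simp add: N_def M_def add.commute)
  have sumP: "(\<Sum>j\<in>N. of_bool (P (j - i)) * zeta n (h * j)) = zeta n (h * i) * L h" for i h
    using sum_shift_zeta[where Q = P and c = "- i" and h = h, OF n P(1)] by (simp add: N_def L_def)
  have sumP': "(\<Sum>j\<in>N. of_bool (P (i - j)) * zeta n (h * j)) = zeta n (h * i) * L h" for i h
    using sumP[of i h] P(2)[of "i - _"] by simp
  show ?thesis
  proof
    assume "\<exists>u v. ?E u v"
    then obtain u v i where i: "i \<in> N" "u i \<noteq> 0 \<or> v i \<noteq> 0"
      and eu: "\<And>i. i \<in> N \<Longrightarrow> (\<Sum>j\<in>N. of_bool (P (j - i)) * u j) + (\<Sum>j\<in>N. of_bool (Q (i + j)) * v j) = k * u i"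
      and ev: "\<And>i. i \<in> N \<Longrightarrow> (\<Sum>j\<in>N. of_bool (Q (i + j)) * u j) + (\<Sum>j\<in>N. of_bool (P (j - i)) * v j) = k * v i"
      by blast
    have swapP: "(\<Sum>i\<in>N. (\<Sum>j\<in>N. of_bool (P (j - i)) * w j) * zeta n (h * i)) = L h * dft n w h" for w h
    proof -
      have "(\<Sum>i\<in>N. (\<Sum>j\<in>N. of_bool (P (j - i)) * w j) * zeta n (h * i))
          = (\<Sum>i\<in>N. \<Sum>j\<in>N. w j * (of_bool (P (j - i)) * zeta n (h * i)))"
        unfolding sum_distrib_right by (simp add: mult_ac)
      also have "\<dots> = (\<Sum>j\<in>N. \<Sum>i\<in>N. w j * (of_bool (P (j - i)) * zeta n (h * i)))"
        by (rule sum.swap)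
      also have "\<dots> = L h * dft n w h"
        by (simp add: sum_distrib_left[symmetric] sumP') (simp add: dft_def N_def sum_distrib_left mult_ac)
      finally show ?thesis .
    qed
    \<comment> \<open>The argument \<open>i + j\<close> turns the character into its conjugate,
      which is why \<open>u\<close> at \<open>- h\<close> is paired with \<open>v\<close> at
      \<open>h\<close> below.\<close>
    have swapQ: "(\<Sum>i\<in>N. (\<Sum>j\<in>N. of_bool (Q (i + j)) * w j) * zeta n (h * i)) = M h * dft n w (- h)" for w h
    proof -
      have "(\<Sum>i\<in>N. (\<Sum>j\<in>N. of_bool (Q (i + j)) * w j) * zeta n (h * i))
          = (\<Sum>i\<in>N. \<Sum>j\<in>N. w j * (of_bool (Q (j + i)) * zeta n (h * i)))"
        unfolding sum_distrib_right by (simp add: mult_ac add.commute)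
      also have "\<dots> = (\<Sum>j\<in>N. \<Sum>i\<in>N. w j * (of_bool (Q (j + i)) * zeta n (h * i)))"
        by (rule sum.swap)
      also have "\<dots> = M h * dft n w (- h)"
        by (simp add: sum_distrib_left[symmetric] sumQ) (simp add: dft_def N_def sum_distrib_left mult_ac)
      finally show ?thesis .
    qed
    have scale: "(\<Sum>i\<in>N. (k * w i) * zeta n (h * i)) = k * dft n w h" for w h
      by (simp add: dft_def N_def sum_distrib_left mult_ac)
    \<comment> \<open>By Fourier inversion a nonzero pair has a nonzero component in some
      block.\<close>
    have "\<exists>h. dft n u (- h) \<noteq> 0 \<or> dft n v h \<noteq> 0"
    proof (rule ccontr)
      assume "\<not> (\<exists>h. dft n u (- h) \<noteq> 0 \<or> dft n v h \<noteq> 0)"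
      then have "dft n u h = 0" "dft n v h = 0" for h by (metis minus_minus)+
      then have "of_nat n * u i = 0" "of_nat n * v i = 0"
        using dft_inversion[OF n, of i u] dft_inversion[OF n, of i v] i(1) by (simp_all add: N_def)
      then show False using i(2) n by simp
    qed
    then obtain h where h: "dft n u (- h) \<noteq> 0 \<or> dft n v h \<noteq> 0" by blast
    have "k * dft n u (- h) = (\<Sum>i\<in>N. ((\<Sum>j\<in>N. of_bool (P (j - i)) * u j) + (\<Sum>j\<in>N. of_bool (Q (i + j)) * v j)) * zeta n (- h * i))"
      unfolding scale[symmetric] by (intro sum.cong refl) (simp add: eu)
    also have "\<dots> = L h * dft n u (- h) + cnj (M h) * dft n v h"
      unfolding distrib_right sum.distrib swapP swapQ by (simp add: Lm Mm)
    finally have 1: "(k - L h) * dft n u (- h) = cnj (M h) * dft n v h" by (simp add: algebra_simps)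
    have "k * dft n v h = (\<Sum>i\<in>N. ((\<Sum>j\<in>N. of_bool (Q (i + j)) * u j) + (\<Sum>j\<in>N. of_bool (P (j - i)) * v j)) * zeta n (h * i))"
      unfolding scale[symmetric] by (intro sum.cong refl) (simp add: ev)
    also have "\<dots> = M h * dft n u (- h) + L h * dft n v h"
      unfolding distrib_right sum.distrib swapP swapQ ..
    finally have 2: "(k - L h) * dft n v h = M h * dft n u (- h)" by (simp add: algebra_simps)
    have "(k - L h)\<^sup>2 * dft n u (- h) = (M h * cnj (M h)) * dft n u (- h)"
      unfolding power2_eq_square mult.assoc 1 by (metis 2 mult.left_commute)
    moreover have "(k - L h)\<^sup>2 * dft n v h = (M h * cnj (M h)) * dft n v h"
      unfolding power2_eq_square mult.assoc 2 by (metis 1 mult.left_commute)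
    ultimately have "(k - L h)\<^sup>2 = M h * cnj (M h)" using h by auto
    then show "\<exists>h. (k - L h)\<^sup>2 = (of_real (cmod (M h)))\<^sup>2" unfolding norm by blast
  next
    assume "\<exists>h. (k - L h)\<^sup>2 = (of_real (cmod (M h)))\<^sup>2"
    then obtain h where h: "(k - L h)\<^sup>2 = M h * cnj (M h)" unfolding norm by blast
    \<comment> \<open>An eigenvector of the block for \<open>k\<close>. If \<open>M h = 0\<close>
      the block is \<open>k\<close> times the identity and any nonzero vector serves.\<close>
    obtain \<alpha> \<beta> where nz: "\<alpha> \<noteq> 0 \<or> \<beta> \<noteq> 0"
      and \<alpha>: "L h * \<alpha> + cnj (M h) * \<beta> = k * \<alpha>" and \<beta>: "M h * \<alpha> + L h * \<beta> = k * \<beta>"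
    proof (cases "M h = 0")
      case True
      then have "k = L h" using h by simp
      then show ?thesis using that[of 1 1] True by simp
    next
      case False
      have "M h * cnj (M h) + L h * (k - L h) = k * (k - L h)"
        unfolding h[symmetric] by (simp add: power2_eq_square algebra_simps)
      then show ?thesis using that[of "cnj (M h)" "k - L h"] False by (simp add: algebra_simps)
    qed
    define u where "u i = \<alpha> * zeta n (h * i)" for i
    define v where "v i = \<beta> * zeta n (- h * i)" for i
    have u: "(\<Sum>j\<in>N. of_bool (R j) * u j) = \<alpha> * (\<Sum>j\<in>N. of_bool (R j) * zeta n (h * j))" for R
      by (simp add: u_def sum_distrib_left mult_ac)
    have v: "(\<Sum>j\<in>N. of_bool (R j) * v j) = \<beta> * (\<Sum>j\<in>N. of_bool (R j) * zeta n (- h * j))" for R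
      by (simp add: v_def sum_distrib_left mult_ac)
    have "(\<Sum>j\<in>N. of_bool (P (j - i)) * u j) + (\<Sum>j\<in>N. of_bool (Q (i + j)) * v j) = k * u i" for i
    proof -
      have "(\<Sum>j\<in>N. of_bool (P (j - i)) * u j) + (\<Sum>j\<in>N. of_bool (Q (i + j)) * v j)
          = (L h * \<alpha> + cnj (M h) * \<beta>) * zeta n (h * i)"
        unfolding u v sumP sumQ Mm by (simp add: algebra_simps)
      then show ?thesis by (simp add: \<alpha> u_def)
    qed
    moreover have "(\<Sum>j\<in>N. of_bool (Q (i + j)) * u j) + (\<Sum>j\<in>N. of_bool (P (j - i)) * v j) = k * v i" for i
    proof -
      have "(\<Sum>j\<in>N. of_bool (Q (i + j)) * u j) + (\<Sum>j\<in>N. of_bool (P (j - i)) * v j)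
          = (M h * \<alpha> + L h * \<beta>) * zeta n (- h * i)"
        unfolding u v sumP sumQ Lm by (simp add: algebra_simps)
      then show ?thesis by (simp add: \<beta> v_def)
    qed
    moreover have "0 \<in> N" "u 0 \<noteq> 0 \<or> v 0 \<noteq> 0" using n nz by (simp_all add: N_def u_def v_def)
    ultimately show "\<exists>u v. ?E u v" by blast
  qed
qed

section \<open>Integrality of the eigenvalues\<close>

lemma cmod_dft_square_algebraic_int:
  assumes n: "n > 0"
  shows "algebraic_int ((cmod (dft n (\<lambda>j. of_bool (Q j)) h))\<^sup>2)"
proof -
  let ?M = "dft n (\<lambda>j. of_bool (Q j)) h"
  have cnj: "cnj ?M = (\<Sum>t\<in>{0..<int n}. of_bool (Q t) * zeta n (- h * t))"
    by (simp add: dft_def cnj_zeta)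
  have "of_real ((cmod ?M)\<^sup>2) = ?M * cnj ?M"
    by (simp add: complex_norm_square[symmetric])
  also have "\<dots> = (\<Sum>(s, t)\<in>{0..<int n} \<times> {0..<int n}. of_bool (Q s) * zeta n (h * s) * (of_bool (Q t) * zeta n (- h * t)))"
    unfolding cnj unfolding dft_def sum_product sum.cartesian_product ..
  \<comment> \<open>The squared modulus is an integer combination of roots of unity, indexed by
    pairs.\<close>
  also have "\<dots> = (\<Sum>x\<in>{0..<int n} \<times> {0..<int n}. of_int (of_bool (Q (fst x) \<and> Q (snd x))) * zeta n (h * (fst x - snd x)))"
    by (intro sum.cong refl) (auto simp: zeta_add[symmetric] right_diff_distrib)
  finally have "algebraic_int (of_real ((cmod ?M)\<^sup>2) :: complex)"
    by (simp only: algebraic_int_zeta_sum[OF n])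
  then show ?thesis by (simp only: algebraic_int_of_real_iff)
qed

text \<open>The given range suffices: \<open>h\<close> and \<open>n - h\<close> give conjugate
  values, and in the remaining cases \<open>h = 0\<close> and \<open>2 * h = n\<close> modulo
  \<open>n\<close> the root of unity is a sign, so the transform itself is an integer.\<close>

lemma int_cmod_dft:
  assumes n: "n > 0"
    and sq: "\<And>h. 1 \<le> h \<Longrightarrow> h \<le> (n - 1) div 2 \<Longrightarrow>
      is_square_number (4 * (cmod (dft n (\<lambda>j. of_bool (Q j)) (int h)))\<^sup>2)"
  shows "cmod (dft n (\<lambda>j. of_bool (Q j)) h) \<in> \<int>"
proof -
  let ?M = "dft n (\<lambda>j. of_bool (Q j))"
  have range: "cmod (?M (int h)) \<in> \<int>" if h: "1 \<le> h" "h \<le> (n - 1) div 2" for h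
  proof -
    obtain w :: int where w: "4 * (cmod (?M (int h)))\<^sup>2 = of_int (w\<^sup>2)"
      using sq[OF h] by (auto simp: is_square_number_def)
    then have "(cmod (?M (int h)))\<^sup>2 = of_int (w\<^sup>2) / 4" by simp
    \<comment> \<open>A rational algebraic integer is an integer, so 4 divides
      \<open>w\<^sup>2\<close> and the modulus is half of the absolute value of
      \<open>w\<close>.\<close>
    then have "(cmod (?M (int h)))\<^sup>2 \<in> \<rat>" by (metis Rats_divide Rats_number_of Rats_of_int)
    then obtain m where m: "(cmod (?M (int h)))\<^sup>2 = of_int m"
      using rational_algebraic_int_is_int cmod_dft_square_algebraic_int[OF n] by (metis Ints_cases)
    then have "real_of_int (4 * m) = of_int (w\<^sup>2)" using w by simp
    then have wm: "w\<^sup>2 = 4 * m" by (simp only: of_int_eq_iff)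
    then have "even (w\<^sup>2)" by simp
    then obtain v where v: "w = 2 * v" by auto
    then have "(cmod (?M (int h)))\<^sup>2 = (of_int v)\<^sup>2" using wm m by simp
    then have "cmod (?M (int h)) = of_int \<bar>v\<bar>" by (metis abs_norm_cancel of_int_abs power2_eq_iff abs_minus_cancel)
    then show ?thesis by simp
  qed
  define r where "r = h mod int n"
  have r: "0 \<le> r" "r < int n" "?M h = ?M r" using n by (simp_all add: r_def dft_mod)
  consider "r = 0 \<or> 2 * r = int n" | "1 \<le> r" "2 * r < int n" | "int n < 2 * r"
    using r by force
  then have "cmod (?M r) \<in> \<int>"
  proof cases
    case 1
    then have "int n dvd 2 * r" by auto
    then have "zeta n (2 * r) = 1" by (simp add: zeta_eq_1_iff[OF n])
    then have "zeta n r * zeta n r = 1" by (simp only: zeta_add mult_2)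
    then have "zeta n r = 1 \<or> zeta n r = - 1" by (simp add: square_eq_1_iff)
    then have "zeta n r \<in> \<int>" by auto
    then have "zeta n (r * j) \<in> \<int>" if "0 \<le> j" for j
      using that zeta_power[of n r "nat j"] by (metis Ints_power int_nat_eq)
    then have "?M r \<in> \<int>" unfolding dft_def by (intro Ints_sum Ints_mult) auto
    then show ?thesis by (auto elim!: Ints_cases simp: norm_of_int)
  next
    case 2
    then show ?thesis using range[of "nat r"] by simp
  next
    case 3
    have "?M (int n - r) = ?M (- r)" using dft_mod[OF n] by (metis diff_0 mod_diff_left_eq mod_self)
    then have "cmod (?M r) = cmod (?M (int (nat (int n - r))))"
      using r by (simp add: dft_uminus_of_bool)
    then show ?thesis using range[of "nat (int n - r)"] 3 r by simp
  qed
  then show ?thesis using r by simp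
qed

lemma int_spectrum_iff:
  fixes P Q :: "int \<Rightarrow> bool"
  assumes n: "n > 0" and P: "\<And>i. P (i mod int n) = P i"
  defines "L \<equiv> dft n (\<lambda>j. of_bool (P j))" and "M \<equiv> dft n (\<lambda>j. of_bool (Q j))"
  shows "(\<forall>k. (\<exists>h. (k - L h)\<^sup>2 = (of_real (cmod (M h)))\<^sup>2) \<longrightarrow> k \<in> \<int>) \<longleftrightarrow>
    gcd_invariant n P \<and> (\<forall>h. 1 \<le> h \<and> h \<le> (n - 1) div 2 \<longrightarrow> is_square_number (4 * (cmod (M (int h)))\<^sup>2))"
    (is "?I \<longleftrightarrow> _ \<and> ?S")
proof
  assume I: ?I
  have ints: "L h \<in> \<int>" "cmod (M h) \<in> \<int>" for h
  proof -
    define c :: complex where "c = of_real (cmod (M h))"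
    have "k \<in> \<int>" if "(k - L h)\<^sup>2 = c\<^sup>2" for k using I that unfolding c_def by blast
    from this[of "L h + c"] this[of "L h - c"] have pm: "L h + c \<in> \<int>" "L h - c \<in> \<int>" by simp_all
    \<comment> \<open>The two eigenvalues only give that \<open>2 * L h\<close> is an integer.
      Halving leaves a rational number, and algebraic integrality of \<open>L h\<close> does the
      rest.\<close>
    then have "(L h + c) + (L h - c) \<in> \<int>" by (rule Ints_add)
    then have "2 * L h \<in> \<rat>" using Ints_subset_Rats by auto
    then have "2 * L h / 2 \<in> \<rat>" by (intro Rats_divide) auto
    moreover have "algebraic_int (L h)"
      using algebraic_int_zeta_sum[OF n, of "\<lambda>j. of_bool (P j)" "\<lambda>j. h * j" "{0..<int n}"]
      by (simp add: L_def dft_def)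
    ultimately show L: "L h \<in> \<int>" using rational_algebraic_int_is_int by simp
    then have "c \<in> \<int>" using Ints_diff[OF pm(1) L] by simp
    then show "cmod (M h) \<in> \<int>" by (simp add: c_def of_real_in_Ints_iff)
  qed
  have ?S
  proof (intro allI impI)
    fix h
    obtain m where "cmod (M (int h)) = of_int m" using ints(2) by (auto elim: Ints_cases)
    then have "4 * (cmod (M (int h)))\<^sup>2 = of_int ((2 * m)\<^sup>2)" by (simp add: power_mult_distrib)
    then show "is_square_number (4 * (cmod (M (int h)))\<^sup>2)" unfolding is_square_number_def by blast
  qed
  then show "gcd_invariant n P \<and> ?S"
    using int_dft_imp_gcd_invariant[where P = P, OF n P] ints(1) unfolding L_def by blast
next
  assume R: "gcd_invariant n P \<and> ?S"
  show ?I
  proof (intro allI impI)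
    fix k assume "\<exists>h. (k - L h)\<^sup>2 = (of_real (cmod (M h)))\<^sup>2"
    then obtain h where "k - L h = of_real (cmod (M h)) \<or> k - L h = - of_real (cmod (M h))"
      by (auto simp: power2_eq_iff)
    then have "k = L h + of_real (cmod (M h)) \<or> k = L h - of_real (cmod (M h))"
      by (auto simp: algebra_simps)
    moreover have "L h \<in> \<int>" using gcd_invariant_imp_int_dft[OF n] R by (simp add: L_def)
    moreover have "of_real (cmod (M h)) \<in> (\<int> :: complex set)"
      using int_cmod_dft[OF n] R unfolding M_def by (simp add: of_real_in_Ints_iff)
    ultimately show "k \<in> \<int>" by auto
  qed
qed

section \<open>Integer coordinates on the dihedral group\<close>

context dihedral_group
begin

definition rot :: "int \<Rightarrow> 'g" where "rot i = a [^] i"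

definition refl :: "int \<Rightarrow> 'g" where "refl i = b \<otimes> a [^] i"

lemma rot_closed [simp]: "rot i \<in> carrier G"
  and refl_closed [simp]: "refl i \<in> carrier G"
  using a_closed b_closed by (simp_all add: rot_def refl_def)

lemma rot_eq_iff: "rot i = rot j \<longleftrightarrow> i mod int n = j mod int n"
proof -
  have "ord a = n" using card_cyclic generate_pow_card[OF a_closed] by simp
  then show ?thesis
    using int_pow_eq[OF a_closed, of i j] by (simp add: rot_def mod_eq_dvd_iff dvd_diff_commute)
qed

lemma rot_mod: "rot (i mod int n) = rot i"
  by (simp add: rot_eq_iff)

lemma refl_rot: "refl i = b \<otimes> rot i"
  by (simp add: refl_def rot_def)

lemma refl_mod: "refl (i mod int n) = refl i"
  by (simp add: refl_rot rot_mod)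

lemma refl_eq_iff: "refl i = refl j \<longleftrightarrow> i mod int n = j mod int n"
  using b_closed by (simp add: refl_rot rot_eq_iff)

lemma rot_rot: "rot i \<otimes> rot j = rot (i + j)"
  using a_closed by (simp add: rot_def int_pow_mult)

lemma rot_nat: "rot (int k) = a [^] k"
  by (simp add: rot_def int_pow_int)

lemma inv_rot: "inv (rot i) = rot (- i)"
  using a_closed by (simp add: rot_def int_pow_neg)

lemma rot_b: "rot i \<otimes> b = refl (- i)"
proof -
  \<comment> \<open>\<open>pow_b\<close> speaks of natural exponents, so the exponent is first
    reduced modulo \<open>n\<close>.\<close>
  define k where "k = nat (i mod int n)"
  have k: "int k = i mod int n" using n_pos by (simp add: k_def)
  have "rot i \<otimes> b = a [^] k \<otimes> b" by (simp add: rot_nat[symmetric] k rot_mod)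
  also have "\<dots> = b \<otimes> inv (rot (int k))" using a_closed by (simp add: pow_b nat_pow_inv rot_nat)
  also have "\<dots> = refl (- int k)" by (simp add: inv_rot refl_rot)
  also have "\<dots> = refl (- i)" by (simp add: k refl_eq_iff mod_simps)
  finally show ?thesis .
qed

lemma refl_times_rot: "refl i \<otimes> rot j = refl (i + j)"
  using b_closed by (simp add: refl_rot m_assoc rot_rot)

lemma rot_times_refl: "rot i \<otimes> refl j = refl (j - i)"
proof -
  have "rot i \<otimes> refl j = (rot i \<otimes> b) \<otimes> rot j" using b_closed by (simp add: refl_rot m_assoc)
  then show ?thesis by (simp add: rot_b refl_times_rot)
qed

lemma refl_times_refl: "refl i \<otimes> refl j = rot (j - i)"
proof -
  have "refl i \<otimes> refl j = b \<otimes> (rot i \<otimes> refl j)" using b_closed by (simp add: refl_rot m_assoc)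
  also have "\<dots> = (b \<otimes> b) \<otimes> rot (j - i)"
    unfolding rot_times_refl using b_closed by (simp add: refl_rot m_assoc)
  finally show ?thesis by (simp add: b_sq)
qed

lemma inv_refl: "inv (refl i) = refl i"
proof (rule inv_equality)
  show "refl i \<otimes> refl i = \<one>" by (simp add: refl_times_refl rot_def)
qed simp_all

lemma cyclic_eq_rot: "generate G {a} = rot ` {0..<int n}"
proof
  show "generate G {a} \<subseteq> rot ` {0..<int n}"
  proof
    fix x assume "x \<in> generate G {a}"
    then obtain k where "x = rot (int k)" by (auto simp: cyclic_eq rot_nat)
    then have "x = rot (int k mod int n)" by (simp add: rot_mod)
    then show "x \<in> rot ` {0..<int n}" using n_pos by (intro image_eqI[of _ _ "int k mod int n"]) auto
  qed
  show "rot ` {0..<int n} \<subseteq> generate G {a}"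
  proof
    fix x assume "x \<in> rot ` {0..<int n}"
    then obtain i where "0 \<le> i" "x = rot i" by auto
    then have "x = a [^] nat i" by (simp add: rot_nat[symmetric])
    then show "x \<in> generate G {a}" by (auto simp: cyclic_eq)
  qed
qed

lemma rot_in_cyclic [simp]: "rot i \<in> generate G {a}"
  using n_pos by (auto simp: cyclic_eq_rot intro!: image_eqI[of _ _ "i mod int n"] rot_mod[symmetric])

lemma coset_eq_refl: "b <# generate G {a} = refl ` {0..<int n}"
  by (auto simp: l_coset_def cyclic_eq_rot refl_rot)

lemma refl_not_in_cyclic: "refl i \<notin> generate G {a}"
  using refl_disjoint rot_in_cyclic[of i] by (auto simp: refl_rot)

lemma rot_not_in_coset: "rot i \<notin> b <# generate G {a}"
  using refl_not_in_cyclic rot_in_cyclic unfolding coset_eq_refl by (metis imageE)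

lemma inj_on_rot: "inj_on rot {0..<int n}"
  and inj_on_refl: "inj_on refl {0..<int n}"
  by (auto simp: inj_on_def rot_eq_iff refl_eq_iff)

lemma carrier_eq: "carrier G = rot ` {0..<int n} \<union> refl ` {0..<int n}"
  using normal_form by (simp add: cyclic_eq_rot image_image refl_rot)

lemma sum_carrier:
  "(\<Sum>x\<in>carrier G. f x) = (\<Sum>i\<in>{0..<int n}. f (rot i)) + (\<Sum>i\<in>{0..<int n}. f (refl i))"
proof -
  have "generate G {a} \<inter> refl ` {0..<int n} = {}" using refl_not_in_cyclic by auto
  then have "rot ` {0..<int n} \<inter> refl ` {0..<int n} = {}" by (simp only: cyclic_eq_rot)
  then show ?thesis
    unfolding carrier_eq by (simp add: sum.union_disjoint sum.reindex inj_on_rot inj_on_refl)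
qed

lemma bex_carrier: "(\<exists>x\<in>carrier G. R x) \<longleftrightarrow> (\<exists>i\<in>{0..<int n}. R (rot i) \<or> R (refl i))"
  and ball_carrier: "(\<forall>x\<in>carrier G. R x) \<longleftrightarrow> (\<forall>i\<in>{0..<int n}. R (rot i)) \<and> (\<forall>i\<in>{0..<int n}. R (refl i))"
  unfolding carrier_eq by blast+

text \<open>Adjacency depends on \<open>j - i\<close> within a coset and on \<open>i + j\<close>
  across cosets, which is the shape of the system in \<open>eigenfunction_iff\<close>.\<close>

lemma inv_times:
  "inv (rot i) \<otimes> rot j = rot (j - i)" "inv (rot i) \<otimes> refl j = refl (i + j)"
  "inv (refl i) \<otimes> rot j = refl (i + j)" "inv (refl i) \<otimes> refl j = rot (j - i)"
  by (simp_all add: inv_rot inv_refl rot_rot rot_times_refl refl_times_rot refl_times_refl add.commute)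

lemma eigenvalue_cayley_graph_iff:
  assumes vs: "distinct vs" "set vs = carrier G" and sym: "\<And>i. rot (- i) \<in> S \<longleftrightarrow> rot i \<in> S"
  shows "eigenvalue (adjacency_matrix (cayley_graph G S) vs) k \<longleftrightarrow>
    (\<exists>h. (k - dft n (\<lambda>j. of_bool (rot j \<in> S)) h)\<^sup>2 =
      (of_real (cmod (dft n (\<lambda>j. of_bool (refl j \<in> S)) h)))\<^sup>2)" (is "_ \<longleftrightarrow> ?R")
proof -
  let ?N = "{0..<int n}"
  let ?E = "\<lambda>u v.
    (\<forall>i\<in>?N. (\<Sum>j\<in>?N. of_bool (rot (j - i) \<in> S) * u j) + (\<Sum>j\<in>?N. of_bool (refl (i + j) \<in> S) * v j) = k * u i) \<and>
    (\<forall>i\<in>?N. (\<Sum>j\<in>?N. of_bool (refl (i + j) \<in> S) * u j) + (\<Sum>j\<in>?N. of_bool (rot (j - i) \<in> S) * v j) = k * v i)"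
  have "eigenvalue (adjacency_matrix (cayley_graph G S) vs) k \<longleftrightarrow>
    (\<exists>f. (\<exists>x\<in>carrier G. f x \<noteq> 0) \<and> (\<forall>x\<in>carrier G. (\<Sum>y\<in>carrier G. of_bool (inv x \<otimes> y \<in> S) * f y) = k * f x))"
    using eigenvalue_adjacency_matrix_iff[of vs "cayley_graph G S" k] vs
    by (simp add: cayley_graph_def cong: conj_cong sum.cong)
  also have "\<dots> \<longleftrightarrow> (\<exists>f. (\<exists>i\<in>?N. f (rot i) \<noteq> 0 \<or> f (refl i) \<noteq> 0) \<and> ?E (\<lambda>i. f (rot i)) (\<lambda>i. f (refl i)))"
    unfolding bex_carrier ball_carrier sum_carrier inv_times ..
  also have "\<dots> \<longleftrightarrow> (\<exists>u v. (\<exists>i\<in>?N. u i \<noteq> 0 \<or> v i \<noteq> 0) \<and> ?E u v)"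
  proof (intro iffI; elim exE)
    fix f assume "(\<exists>i\<in>?N. f (rot i) \<noteq> 0 \<or> f (refl i) \<noteq> 0) \<and> ?E (\<lambda>i. f (rot i)) (\<lambda>i. f (refl i))"
    then show "\<exists>u v. (\<exists>i\<in>?N. u i \<noteq> 0 \<or> v i \<noteq> 0) \<and> ?E u v"
      by (intro exI[of _ "\<lambda>i. f (rot i)"] exI[of _ "\<lambda>i. f (refl i)"])
  next
    fix u v assume uv: "(\<exists>i\<in>?N. u i \<noteq> 0 \<or> v i \<noteq> 0) \<and> ?E u v"
    \<comment> \<open>The two functions are glued along the disjoint cosets; injectivity on one
      period recovers the exponent from the group element.\<close>
    define f where "f x = (if x \<in> generate G {a} then u (the_inv_into ?N rot x) else v (the_inv_into ?N refl x))" for x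
    have "f (rot i) = u i" "f (refl i) = v i" if "i \<in> ?N" for i
      using that refl_not_in_cyclic by (simp_all add: f_def the_inv_into_f_f inj_on_rot inj_on_refl del: atLeastLessThan_iff)
    then have "(\<exists>i\<in>?N. f (rot i) \<noteq> 0 \<or> f (refl i) \<noteq> 0) \<and> ?E (\<lambda>i. f (rot i)) (\<lambda>i. f (refl i))"
      using uv by (simp cong: sum.cong ball_cong bex_cong del: atLeastLessThan_iff)
    then show "\<exists>f. (\<exists>i\<in>?N. f (rot i) \<noteq> 0 \<or> f (refl i) \<noteq> 0) \<and> ?E (\<lambda>i. f (rot i)) (\<lambda>i. f (refl i))"
      by (intro exI[of _ f])
  qed
  also have "\<dots> \<longleftrightarrow> ?R"
    by (rule eigenfunction_iff) (use n_pos sym in \<open>simp_all add: rot_mod refl_mod\<close>)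
  finally show ?thesis .
qed

lemma integral_cayley_graph_iff:
  assumes sym: "\<And>i. rot (- i) \<in> S \<longleftrightarrow> rot i \<in> S"
  shows "integral_graph (cayley_graph G S) \<longleftrightarrow> gcd_invariant n (\<lambda>i. rot i \<in> S) \<and>
    (\<forall>h. 1 \<le> h \<and> h \<le> (n - 1) div 2 \<longrightarrow>
      is_square_number (4 * (cmod (dft n (\<lambda>j. of_bool (refl j \<in> S)) (int h)))\<^sup>2))"
proof -
  let ?X = "cayley_graph G S"
  let ?R = "\<lambda>k. \<exists>h. (k - dft n (\<lambda>j. of_bool (rot j \<in> S)) h)\<^sup>2 =
      (of_real (cmod (dft n (\<lambda>j. of_bool (refl j \<in> S)) h)))\<^sup>2"
  have X: "pverts ?X = carrier G" by (simp add: cayley_graph_def)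
  have ev: "eigenvalue (adjacency_matrix ?X vs) k \<longleftrightarrow> ?R k" if "distinct vs" "set vs = carrier G" for vs k
    using that sym by (rule eigenvalue_cayley_graph_iff)
  \<comment> \<open>An actual ordering is exhibited because integrality quantifies over all
    orderings and would otherwise yield nothing.\<close>
  obtain vs where vs: "distinct vs" "set vs = carrier G"
    using finite_distinct_list[OF finite_carrier] by blast
  have "integral_graph ?X \<longleftrightarrow> (\<forall>k. ?R k \<longrightarrow> k \<in> \<int>)"
  proof
    assume "integral_graph ?X"
    then have "\<forall>k. eigenvalue (adjacency_matrix ?X vs) k \<longrightarrow> k \<in> \<int>"
      unfolding integral_graph_def X using vs by blast
    then show "\<forall>k. ?R k \<longrightarrow> k \<in> \<int>" unfolding ev[OF vs] .
  next
    assume "\<forall>k. ?R k \<longrightarrow> k \<in> \<int>"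
    then show "integral_graph ?X"
      unfolding integral_graph_def X using finite_carrier ev by blast
  qed
  also have "\<dots> \<longleftrightarrow> gcd_invariant n (\<lambda>i. rot i \<in> S) \<and>
    (\<forall>h. 1 \<le> h \<and> h \<le> (n - 1) div 2 \<longrightarrow>
      is_square_number (4 * (cmod (dft n (\<lambda>j. of_bool (refl j \<in> S)) (int h)))\<^sup>2))"
    by (rule int_spectrum_iff) (use n_pos in \<open>simp_all add: rot_mod\<close>)
  finally show ?thesis .
qed

section \<open>Subgroups of the rotation group and gcd classes\<close>

lemma rot_same_subgroups_iff:
  "(\<forall>H. subgroup H (cyclic_subgroup G a) \<longrightarrow> (rot i \<in> H \<longleftrightarrow> rot j \<in> H)) \<longleftrightarrow> gcd i (int n) = gcd j (int n)"
proof
  assume eq: "gcd i (int n) = gcd j (int n)"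
  have "rot j \<in> H" if H: "subgroup H (cyclic_subgroup G a)" and "rot i \<in> H"
    and eq: "gcd i (int n) = gcd j (int n)" for i j H
  proof -
    \<comment> \<open>Each of the two rotations is a power of the other, so a subgroup containing
      one contains both.\<close>
    obtain m where m: "j mod int n = (int m * i) mod int n"
      using eq_gcd_imp_coprime_multiple[OF _ eq] n_pos by auto
    have "rot (int m * i) \<in> H"
    proof (induction m)
      case 0
      then show ?case using subgroup.one_closed[OF H] by (simp add: rot_def)
    next
      case (Suc m)
      have "rot i \<otimes> rot (int m * i) \<in> H" using subgroup.m_closed[OF H \<open>rot i \<in> H\<close> Suc] by simp
      then show ?case by (simp add: rot_rot ring_distribs)
    qed
    then show "rot j \<in> H" using m by (metis rot_eq_iff)
  qed
  then show "\<forall>H. subgroup H (cyclic_subgroup G a) \<longrightarrow> (rot i \<in> H \<longleftrightarrow> rot j \<in> H)"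
    using eq by metis
next
  assume R: "\<forall>H. subgroup H (cyclic_subgroup G a) \<longrightarrow> (rot i \<in> H \<longleftrightarrow> rot j \<in> H)"
  have multiples: "subgroup (rot ` {k. d dvd k}) (cyclic_subgroup G a)" for d
  proof (rule subgroup_incl)
    show "subgroup (rot ` {k. d dvd k}) G"
    proof (rule subgroupI)
      show "rot ` {k. d dvd k} \<noteq> {}" by (auto intro: dvd_0_right)
    qed (auto simp: inv_rot rot_rot)
    show "subgroup (generate G {a}) G" using a_closed by (simp add: generate_is_subgroup)
  qed auto
  \<comment> \<open>Since \<open>d\<close> divides \<open>n\<close>, divisibility by
    \<open>d\<close> depends only on the residue, so these subgroups detect it. Taking
    \<open>d\<close> to be each of the two gcds makes them divide each other.\<close>
  have mem: "rot l \<in> rot ` {k. d dvd k} \<longleftrightarrow> d dvd l" if "d dvd int n" for d l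
  proof
    assume "rot l \<in> rot ` {k. d dvd k}"
    then obtain k where "d dvd k" "l mod int n = k mod int n" by (auto simp: rot_eq_iff)
    then show "d dvd l" using that by (metis mod_invariant_dvd)
  qed simp
  have "gcd i (int n) dvd j" "gcd j (int n) dvd i"
    using R multiples mem[of "gcd i (int n)"] mem[of "gcd j (int n)"] by (metis gcd_dvd1 gcd_dvd2)+
  then show "gcd i (int n) = gcd j (int n)"
    by (intro zdvd_antisym_nonneg) auto
qed

lemma subgroup_algebra_cyclic_iff:
  assumes A: "A \<subseteq> generate G {a}"
  shows "A \<in> subgroup_algebra (cyclic_subgroup G a) \<longleftrightarrow> gcd_invariant n (\<lambda>i. rot i \<in> A)"
proof -
  interpret C: group "cyclic_subgroup G a"
    using a_closed by (intro subgroup_imp_group generate_is_subgroup) simp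
  have "finite (generate G {a})" by (simp add: cyclic_eq_rot)
  then have "A \<in> subgroup_algebra (cyclic_subgroup G a) \<longleftrightarrow>
    (\<forall>x\<in>generate G {a}. \<forall>y\<in>generate G {a}.
      (\<forall>H. subgroup H (cyclic_subgroup G a) \<longrightarrow> (x \<in> H \<longleftrightarrow> y \<in> H)) \<longrightarrow> (x \<in> A \<longleftrightarrow> y \<in> A))"
    using C.subgroup_algebra_iff[of A] A by simp
  also have "\<dots> \<longleftrightarrow> (\<forall>i j. (\<forall>H. subgroup H (cyclic_subgroup G a) \<longrightarrow> (rot i \<in> H \<longleftrightarrow> rot j \<in> H)) \<longrightarrow> (rot i \<in> A \<longleftrightarrow> rot j \<in> A))"
    (is "?X \<longleftrightarrow> ?Y")
  proof
    assume ?X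
    then show ?Y using rot_in_cyclic by blast
  next
    assume ?Y
    then show ?X unfolding cyclic_eq_rot by blast
  qed
  finally show ?thesis unfolding rot_same_subgroups_iff gcd_invariant_def by simp
qed

section \<open>The character sum as a squared modulus\<close>

lemma dihedral_char_rot_int: "dihedral_char G n a h (rot i) = 2 * Re (zeta n (int h * i))"
proof -
  define k where "k = nat (i mod int n)"
  have k: "int k = i mod int n" using n_pos by (simp add: k_def)
  have "dihedral_char G n a h (rot i) = dihedral_char G n a h (a [^] k)"
    by (simp add: rot_nat[symmetric] k rot_mod)
  also have "\<dots> = 2 * Re (zeta n (int h * int k))"
    by (simp add: dihedral_char_rot zeta_def mult_ac)
  also have "zeta n (int h * int k) = zeta n (int h * i)"
    using n_pos by (simp add: k zeta_mult_mod)
  finally show ?thesis .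
qed

text \<open>The product of the reflections with exponents \<open>s\<close> and \<open>t\<close> is
  the rotation by \<open>t - s\<close>, so the double sum of character values factors into a
  transform times its conjugate.\<close>

lemma mset_char_square_refl:
  assumes A: "A \<subseteq> b <# generate G {a}"
  shows "mset_char (dihedral_char G n a h) (mset_square G A) =
    2 * (cmod (dft n (\<lambda>j. of_bool (refl j \<in> A)) (int h)))\<^sup>2"
proof -
  define J where "J = {j \<in> {0..<int n}. refl j \<in> A}"
  have AJ: "A = refl ` J" using A by (auto simp: J_def coset_eq_refl)
  have inj: "inj_on refl J" using inj_on_refl by (rule inj_on_subset) (auto simp: J_def)
  have M: "dft n (\<lambda>j. of_bool (refl j \<in> A)) (int h) = (\<Sum>j\<in>J. zeta n (int h * j))"
    by (simp add: dft_def J_def Int_def)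
  have "mset_char (dihedral_char G n a h) (mset_square G A)
      = (\<Sum>(x, y)\<in>A \<times> A. dihedral_char G n a h (x \<otimes> y))"
    by (simp add: mset_char_def mset_square_def sum_unfold_sum_mset image_mset.compositionality comp_def case_prod_unfold)
  also have "\<dots> = (\<Sum>s\<in>J. \<Sum>t\<in>J. dihedral_char G n a h (refl s \<otimes> refl t))"
    unfolding AJ by (simp add: sum.cartesian_product[symmetric] sum.reindex inj)
  also have "\<dots> = (\<Sum>s\<in>J. \<Sum>t\<in>J. 2 * Re (zeta n (int h * t) * cnj (zeta n (int h * s))))"
    by (simp add: refl_times_refl dihedral_char_rot_int right_diff_distrib cnj_zeta zeta_add[symmetric])
  also have "\<dots> = 2 * Re ((\<Sum>t\<in>J. zeta n (int h * t)) * cnj (\<Sum>s\<in>J. zeta n (int h * s)))"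
    unfolding cnj_sum sum_product Re_sum by (subst sum.swap) (simp add: sum_distrib_left)
  also have "\<dots> = 2 * (cmod (dft n (\<lambda>j. of_bool (refl j \<in> A)) (int h)))\<^sup>2"
    unfolding M complex_norm_square[symmetric] by simp
  finally show ?thesis .
qed

end

theorem theorem3p3:
  fixes G :: "('g, 'm) monoid_scheme" and n :: nat and a b :: 'g and S S1 S2 :: "'g set"
  assumes "dihedral_group G n a b"
    and "S \<subseteq> carrier G - {\<one>\<^bsub>G\<^esub>}"
    and "S = set_inv\<^bsub>G\<^esub> S"
    and "S = S1 \<union> S2"
    and "S1 \<subseteq> generate G {a}"
    and "S2 \<subseteq> b <#\<^bsub>G\<^esub> generate G {a}"
  shows "integral_graph (cayley_graph G S) \<longleftrightarrow>
    S1 \<in> subgroup_algebra (cyclic_subgroup G a) \<and>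
    (\<forall>h. 1 \<le> h \<and> h \<le> (n - 1) div 2 \<longrightarrow>
       is_square_number (2 * mset_char (dihedral_char G n a h) (mset_square G S2)))"
proof -
  interpret dihedral_group G n a b by (rule assms(1))
  have "rot (- i) \<in> S" if "rot i \<in> S" for i
  proof -
    have "inv\<^bsub>G\<^esub> (rot i) \<in> set_inv\<^bsub>G\<^esub> S" using that by (auto simp: SET_INV_def)
    then show ?thesis using assms(3) by (simp add: inv_rot)
  qed
  then have sym: "rot (- i) \<in> S \<longleftrightarrow> rot i \<in> S" for i by (metis minus_minus)
  \<comment> \<open>The cosets are disjoint, so rotations see only \<open>S1\<close> and reflections
    only \<open>S2\<close>. Doubling the character sum then gives the factor 4 of
    \<open>integral_cayley_graph_iff\<close>.\<close>
  have "rot i \<in> S \<longleftrightarrow> rot i \<in> S1" "refl i \<in> S \<longleftrightarrow> refl i \<in> S2" for i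
    using assms(4,5,6) rot_not_in_coset[of i] refl_not_in_cyclic[of i] by auto
  then show ?thesis
    using integral_cayley_graph_iff[OF sym] subgroup_algebra_cyclic_iff[OF assms(5)]
    by (simp add: mset_char_square_refl[OF assms(6)])
qed

end
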